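(* Let $X$ be an uncountable subset of $\omega_1$ and let $G=\mathrm{grp}(\mathcal{L}_X)\cdot \mathrm{pr}_X K\subset\mathbb{T}^X$, where $$K=\{(z_\alpha^{p_\alpha})_{\alpha<\omega_1}:\ p_\alpha\in\mathbb{Z}\text{ for all }\alpha<\omega_1,\ \sup\{|p_\alpha|:\alpha<\omega_1\}<\infty\}\subset\mathbb{T}^{\omega_1}.$$ Then $G$ is Lindelöf.
   Context: For a subset $A$ of a group, $\mathrm{grp}(A)$ is the smallest subgroup containing $A$. $\mathrm{pr}_X:\mathbb{T}^{\omega_1}\to\mathbb{T}^X$ is the restriction (projection) map. $G$ carries the subspace topology from $\mathbb{T}^X$. The function $\mathrm{osc}$ (Moore). Let $(e_\alpha)_{\alpha<\omega_1}$ be a coherent sequence: $e_\alpha:\alpha\to\omega$ is finite-to-one, and for all $\alpha<\beta$ the set $\{\xi<\alpha: e_\alpha(\xi)\ne e_\beta(\xi)\}$ is finite. Let $L:\{(\alpha,\beta)\in\omega_1^2:\alpha\le\beta\}\to[\omega_1]^{<\omega}$ be a function such that: (i) $L(\alpha,\beta)\subset\alpha$, and $L(\alpha,\beta)=\emptyset$ iff $\alpha=0$ or $\alpha=\beta$; (ii) if $\alpha\le\beta\le\gamma$ and $L(\beta,\gamma)<L(\alpha,\beta)$ (every element of the first set is less than every element of the second), then $L(\alpha,\gamma)=L(\beta,\gamma)\cup L(\alpha,\beta)$; (iii) if $\beta$ is a limit ordinal, then $\lim_{\alpha\to\beta}\min L(\alpha,\beta)=\beta$. For $\alpha<\beta<\omega_1$,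 $\mathrm{osc}(\alpha,\beta)\in\omega$ is the cardinality of the set of all $\xi\in L(\alpha,\beta)\setminus\{\min L(\alpha,\beta)\}$ such that $e_\alpha(\xi^-)=e_\beta(\xi^-)$ and $e_\alpha(\xi)>e_\beta(\xi)$, where $\xi^-$ is the greatest element of $L(\alpha,\beta)$ smaller than $\xi$. Moore's choice of these objects, which is fixed here, has the following property (a known theorem of Moore, which may be assumed): for all uncountable families $\mathcal{A}\subset[\omega_1]^k$ and $\mathcal{B}\subset[\omega_1]^l$ of pairwise disjoint sets and every $n\in\omega$ there exist $a\in\mathcal{A}$ and $b_m\in\mathcal{B}$ ($m<n$) such that for all $i<k$, $j<l$, $m<n$: $a<b_m$ (i.e. $\max a<\min b_m$) and $\mathrm{osc}(a(i),b_m(j))=\mathrm{osc}(a(i),b_0(j))+m$. Here $a(i)$ denotes the $i$-th element of $a$ in increasing order (starting from $i=0$). Let $\mathbb{T}=\{z\in\mathbb{C}:|z|=1\}$ (a multiplicative group), and fix a sequence $(z_\alpha)_{\alpha<\omega_1}$ of rationally independent points of $\mathbb{T}$ (no nontrivial finite product of integer powers of distinct $z_\alpha$'s equals $1$). For $\alpha<\beta<\omega_1$ put $o(\alpha,\beta)=z_\alpha^{\mathrm{osc}(\alpha,\beta)+1}$. Define $w_\beta\in\mathbb{T}^{\omega_1}$ by $w_\beta(\alpha)=o(\alpha,\beta)$ if $\alpha<\beta$ and $w_\beta(\alpha)=1$ otherwise. For $X\subset\omega_1$ let $\mathcal{L}_X=\{w_\beta|X:\beta\in X\}\subset\mathbb{T}^X$,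 where $\mathbb{T}^X$ has the product topology and coordinatewise multiplication.
   Formalization: Condition (ii) on L is required only for α > 0: at α = 0 < β < γ the set L(0,β) is empty, so (ii) as written would force L(β,γ) = ∅, contradicting (i); Moore's function satisfies the corrected condition. *)

theory Defs
  imports "HOL-Analysis.Analysis" "HOL-Algebra.Product_Groups"
begin

text \<open>
  The ordinal \<open>\<omega>\<^sub>1\<close> is represented by an arbitrary uncountable well-ordered type all of whose
  proper initial segments are countable; an ordinal \<open>\<alpha> < \<omega>\<^sub>1\<close>, viewed as a set, is \<open>{..<\<alpha>}\<close>.
\<close>

definition is_omega1 :: "'a::wellorder itself \<Rightarrow> bool" where
  "is_omega1 _ \<longleftrightarrow> uncountable (UNIV :: 'a set) \<and> (\<forall>\<alpha>::'a. countable {..<\<alpha>})"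

definition zero_ord :: "'a::wellorder \<Rightarrow> bool" where
  "zero_ord \<alpha> \<longleftrightarrow> {..<\<alpha>} = {}"

definition limit_ord :: "'a::wellorder \<Rightarrow> bool" where
  "limit_ord \<beta> \<longleftrightarrow> {..<\<beta>} \<noteq> {} \<and> (\<forall>\<gamma><\<beta>. \<exists>\<delta><\<beta>. \<gamma> < \<delta>)"

definition set_less :: "'a::order set \<Rightarrow> 'a set \<Rightarrow> bool" where
  "set_less A B \<longleftrightarrow> (\<forall>x\<in>A. \<forall>y\<in>B. x < y)"

text \<open>Only the values \<open>e \<alpha> \<xi>\<close> with \<open>\<xi> < \<alpha>\<close> and \<open>L \<alpha> \<beta>\<close> with \<open>\<alpha> \<le> \<beta>\<close> are meaningful below.\<close>

definition coherent_seq :: "('a::wellorder \<Rightarrow> 'a \<Rightarrow> nat) \<Rightarrow> bool" where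
  "coherent_seq e \<longleftrightarrow>
     (\<forall>\<alpha> n. finite {\<xi>. \<xi> < \<alpha> \<and> e \<alpha> \<xi> = n}) \<and>
     (\<forall>\<alpha> \<beta>. \<alpha> < \<beta> \<longrightarrow> finite {\<xi>. \<xi> < \<alpha> \<and> e \<alpha> \<xi> \<noteq> e \<beta> \<xi>})"

text \<open>
  The second clause is required for \<open>\<alpha> \<noteq> 0\<close> only.  At \<open>\<alpha> = 0 < \<beta> < \<gamma>\<close> it
  would contradict the first clause: \<open>L 0 \<beta> = {}\<close> makes its premise vacuous, and its
  conclusion would read \<open>{} = L \<beta> \<gamma>\<close>.  The last clause says that \<open>Min (L \<alpha> \<beta>)\<close>, which is less than
  \<open>\<beta>\<close>, tends to \<open>\<beta>\<close> in the order topology as \<open>\<alpha>\<close> tends to the limit ordinal \<open>\<beta>\<close> from below.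
\<close>

definition lower_trace :: "('a::wellorder \<Rightarrow> 'a \<Rightarrow> 'a set) \<Rightarrow> bool" where
  "lower_trace L \<longleftrightarrow>
     (\<forall>\<alpha> \<beta>. \<alpha> \<le> \<beta> \<longrightarrow>
        finite (L \<alpha> \<beta>) \<and> L \<alpha> \<beta> \<subseteq> {..<\<alpha>} \<and> (L \<alpha> \<beta> = {} \<longleftrightarrow> zero_ord \<alpha> \<or> \<alpha> = \<beta>)) \<and>
     (\<forall>\<alpha> \<beta> \<gamma>. \<not> zero_ord \<alpha> \<longrightarrow> \<alpha> \<le> \<beta> \<longrightarrow> \<beta> \<le> \<gamma> \<longrightarrow> set_less (L \<beta> \<gamma>) (L \<alpha> \<beta>) \<longrightarrow>
        L \<alpha> \<gamma> = L \<beta> \<gamma> \<union> L \<alpha> \<beta>) \<and>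
     (\<forall>\<beta>. limit_ord \<beta> \<longrightarrow>
        (\<forall>\<gamma><\<beta>. \<exists>\<delta><\<beta>. \<forall>\<alpha>. \<delta> < \<alpha> \<and> \<alpha> < \<beta> \<longrightarrow> \<gamma> < Min (L \<alpha> \<beta>)))"

definition osc :: "('a::wellorder \<Rightarrow> 'a \<Rightarrow> nat) \<Rightarrow> ('a \<Rightarrow> 'a \<Rightarrow> 'a set) \<Rightarrow> 'a \<Rightarrow> 'a \<Rightarrow> nat" where
  "osc e L \<alpha> \<beta> =
     card {\<xi> \<in> L \<alpha> \<beta> - {Min (L \<alpha> \<beta>)}.
             (let \<xi>' = Max {\<zeta> \<in> L \<alpha> \<beta>. \<zeta> < \<xi>} in e \<alpha> \<xi>' = e \<beta> \<xi>' \<and> e \<alpha> \<xi> > e \<beta> \<xi>)}"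

text \<open>The conclusion of Moore's theorem, for a function \<open>f\<close> in place of \<open>osc\<close>.\<close>

definition k_subsets :: "nat \<Rightarrow> 'a set set" where
  "k_subsets k = {a. finite a \<and> card a = k}"

definition moore_property :: "('a::wellorder \<Rightarrow> 'a \<Rightarrow> nat) \<Rightarrow> bool" where
  "moore_property f \<longleftrightarrow>
     (\<forall>k l \<A> \<B> n.
        \<A> \<subseteq> k_subsets k \<and> uncountable \<A> \<and> pairwise disjnt \<A> \<and>
        \<B> \<subseteq> k_subsets l \<and> uncountable \<B> \<and> pairwise disjnt \<B> \<longrightarrow>
        (\<exists>a\<in>\<A>. \<exists>b::nat \<Rightarrow> 'a set. (\<forall>m<n. b m \<in> \<B>) \<and>
           (\<forall>i<k. \<forall>j<l. \<forall>m<n.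
              set_less a (b m) \<and>
              f (sorted_list_of_set a ! i) (sorted_list_of_set (b m) ! j) =
                f (sorted_list_of_set a ! i) (sorted_list_of_set (b 0) ! j) + m)))"

definition circle_group :: "complex monoid" where
  "circle_group = \<lparr>carrier = sphere 0 1, monoid.mult = (*), one = 1\<rparr>"

text \<open>Elements of \<open>\<T>\<^sup>X\<close> are the extensional functions on \<open>X\<close> with values in the circle.\<close>

definition torus_group :: "'a set \<Rightarrow> ('a \<Rightarrow> complex) monoid" where
  "torus_group X = product_group X (\<lambda>_. circle_group)"

definition torus_topology :: "'a set \<Rightarrow> ('a \<Rightarrow> complex) topology" where
  "torus_topology X = product_topology (\<lambda>_. top_of_set (sphere 0 1)) X"

definition rationally_independent :: "('a \<Rightarrow> complex) \<Rightarrow> bool" where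
  "rationally_independent z \<longleftrightarrow>
     (\<forall>F (p :: 'a \<Rightarrow> int). finite F \<and> (\<Prod>\<alpha>\<in>F. z \<alpha> powi p \<alpha>) = 1 \<longrightarrow> (\<forall>\<alpha>\<in>F. p \<alpha> = 0))"

definition w_point ::
  "('a::wellorder \<Rightarrow> 'a \<Rightarrow> nat) \<Rightarrow> ('a \<Rightarrow> 'a \<Rightarrow> 'a set) \<Rightarrow> ('a \<Rightarrow> complex) \<Rightarrow> 'a \<Rightarrow> 'a \<Rightarrow> complex" where
  "w_point e L z \<beta> \<alpha> = (if \<alpha> < \<beta> then z \<alpha> ^ (osc e L \<alpha> \<beta> + 1) else 1)"

definition L_space ::
  "('a::wellorder \<Rightarrow> 'a \<Rightarrow> nat) \<Rightarrow> ('a \<Rightarrow> 'a \<Rightarrow> 'a set) \<Rightarrow> ('a \<Rightarrow> complex) \<Rightarrow> 'a set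
     \<Rightarrow> ('a \<Rightarrow> complex) set" where
  "L_space e L z X = (\<lambda>\<beta>. restrict (w_point e L z \<beta>) X) ` X"

definition K_set :: "('a \<Rightarrow> complex) \<Rightarrow> ('a \<Rightarrow> complex) set" where
  "K_set z = {(\<lambda>\<alpha>. z \<alpha> powi p \<alpha>) | p :: 'a \<Rightarrow> int. bdd_above (range (\<lambda>\<alpha>. \<bar>p \<alpha>\<bar>))}"

definition G_set ::
  "('a::wellorder \<Rightarrow> 'a \<Rightarrow> nat) \<Rightarrow> ('a \<Rightarrow> 'a \<Rightarrow> 'a set) \<Rightarrow> ('a \<Rightarrow> complex) \<Rightarrow> 'a set
     \<Rightarrow> ('a \<Rightarrow> complex) set" where
  "G_set e L z X =
     generate (torus_group X) (L_space e L z X) <#>\<^bsub>torus_group X\<^esub> (\<lambda>f. restrict f X) ` K_set z"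

end

theory Submission
  imports Defs
begin

text \<open>
  Every element of \<open>G\<close> has coordinates \<open>z \<alpha> powi q \<alpha>\<close>, where \<open>q\<close> is the sum of the exponent of a
  word in the generators \<open>w\<^sub>\<beta>\<close> and of a bounded integer function.  For a fixed word and a fixed bound
  \<open>n\<close> these elements form a product of finite sets, hence a compact set; finitely many members of a
  given open cover suffice for it, and they even cover a tube around it that depends on finitely many
  coordinates and a radius (\<open>compactin_product_tube\<close>).

  Choose \<open>\<delta> < \<omega>\<^sub>1\<close> closed under all the relevant countable data.  The countably many tubes that belong
  to words below \<open>\<delta>\<close> cover \<open>G\<close>.  Indeed, let \<open>y \<in> G\<close> and split its word into the letters
  below \<open>\<delta>\<close> and the tail of letters at or above \<open>\<delta>\<close>.  Two cases arise, according to the sum \<open>M\<close> of the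
  exponents in the tail.

  If \<open>M = 0\<close>, then the tail contributes a bounded exponent on the coordinates below \<open>\<delta>\<close>, because
  \<open>osc \<alpha> \<beta> - osc \<alpha> \<gamma>\<close> is bounded for \<open>\<alpha> < \<delta> \<le> \<beta>, \<gamma>\<close> (\<open>osc_difference_bounded\<close>).  So on the
  coordinates that the tubes of words below \<open>\<delta>\<close> can see, the tail is indistinguishable from an element of \<open>K\<close>.

  If \<open>M \<noteq> 0\<close>, Moore's theorem applies (\<open>word_approximation\<close>).  If no stage \<open>\<gamma>\<close> allowed all tails
  above \<open>\<gamma>\<close> to be approximated by words below \<open>\<gamma>\<close>, there would be uncountably many disjoint bad tails
  \<open>b\<^sub>\<gamma>\<close>, and the supports of the tubes could be arranged into a delta system.  Moore's theorem
  provides one support \<open>a\<close> and tails \<open>b\<^sub>0, b\<^sub>1, \<dots>\<close> above it along which the exponent at each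
  \<open>\<alpha> \<in> a\<close> runs through an arithmetic progression of difference \<open>M\<close>.  Since the \<open>z \<alpha>\<close> are rationally
  independent, Kronecker's theorem puts one of these points into the prescribed tube.
\<close>

section \<open>Differences of oscillations are bounded\<close>

text \<open>
  For \<open>\<alpha>\<close> close to the limit \<open>\<delta>\<close>, the minimum of \<open>L \<alpha> \<delta>\<close> exceeds the finite set \<open>L \<delta> \<beta>\<close>, so that
  \<open>L \<alpha> \<beta> = L \<delta> \<beta> \<union> L \<alpha> \<delta>\<close>.  The two oscillations can then only disagree at points of \<open>L \<delta> \<beta>\<close>, at the
  minimum of \<open>L \<alpha> \<delta>\<close>, and at points which, or whose predecessors, lie in the finite set where
  \<open>e \<delta>\<close> and \<open>e \<beta>\<close> differ.
\<close>
lemma osc_bounded_limit: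
  fixes e :: "'a::wellorder \<Rightarrow> 'a \<Rightarrow> nat"
  assumes coh: "coherent_seq e" and lt: "lower_trace L" and lim: "limit_ord \<delta>" and "\<delta> \<le> \<beta>"
  shows "\<exists>\<eta><\<delta>. \<exists>n. \<forall>\<alpha>. \<eta> < \<alpha> \<and> \<alpha> < \<delta> \<longrightarrow> \<bar>int (osc e L \<alpha> \<beta>) - int (osc e L \<alpha> \<delta>)\<bar> \<le> n"
proof (cases "\<delta> = \<beta>")
  case True
  then show ?thesis using lim by (auto simp: limit_ord_def)
next
  case False
  then have "\<delta> < \<beta>" using \<open>\<delta> \<le> \<beta>\<close> by simp
  have L: "finite (L \<alpha> \<beta>)" "L \<alpha> \<beta> \<subseteq> {..<\<alpha>}" "L \<alpha> \<beta> = {} \<longleftrightarrow> zero_ord \<alpha> \<or> \<alpha> = \<beta>" if "\<alpha> \<le> \<beta>" for \<alpha> \<beta>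
    using lt that unfolding lower_trace_def by auto
  have Lun: "L \<alpha> \<gamma> = L \<beta> \<gamma> \<union> L \<alpha> \<beta>"
    if "\<not> zero_ord \<alpha>" "\<alpha> \<le> \<beta>" "\<beta> \<le> \<gamma>" "set_less (L \<beta> \<gamma>) (L \<alpha> \<beta>)" for \<alpha> \<beta> \<gamma>
    using lt that unfolding lower_trace_def by blast
  define F where "F = {\<xi>. \<xi> < \<delta> \<and> e \<delta> \<xi> \<noteq> e \<beta> \<xi>}"
  have finF: "finite F"
    using coh \<open>\<delta> < \<beta>\<close> unfolding coherent_seq_def F_def by blast
  have ne: "L \<delta> \<beta> \<noteq> {}"
    using L(3)[of \<delta> \<beta>] \<open>\<delta> < \<beta>\<close> lim by (auto simp: limit_ord_def zero_ord_def)
  have finL: "finite (L \<delta> \<beta>)" using L(1) \<open>\<delta> \<le> \<beta>\<close> by blast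
  have "Max (L \<delta> \<beta>) < \<delta>"
    using Max_in[OF finL ne] L(2)[OF \<open>\<delta> \<le> \<beta>\<close>] by auto
  then obtain \<eta> where "\<eta> < \<delta>" and \<eta>: "\<And>\<alpha>. \<eta> < \<alpha> \<Longrightarrow> \<alpha> < \<delta> \<Longrightarrow> Max (L \<delta> \<beta>) < Min (L \<alpha> \<delta>)"
  proof -
    have "\<forall>\<gamma><\<delta>. \<exists>\<eta><\<delta>. \<forall>\<alpha>. \<eta> < \<alpha> \<and> \<alpha> < \<delta> \<longrightarrow> \<gamma> < Min (L \<alpha> \<delta>)"
      using lt lim unfolding lower_trace_def by simp
    then show ?thesis using \<open>Max (L \<delta> \<beta>) < \<delta>\<close> that by meson
  qed
  define n where "n = int (card (L \<delta> \<beta>)) + 1 + 2 * int (card F)"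
  have "\<bar>int (osc e L \<alpha> \<beta>) - int (osc e L \<alpha> \<delta>)\<bar> \<le> n" if "\<eta> < \<alpha>" "\<alpha> < \<delta>" for \<alpha>
  proof -
    define A where "A = L \<alpha> \<delta>"
    define B where "B = L \<delta> \<beta>"
    have nz: "\<not> zero_ord \<alpha>" using \<open>\<eta> < \<alpha>\<close> by (auto simp: zero_ord_def)
    have A: "finite A" "A \<noteq> {}" "A \<subseteq> {..<\<alpha>}"
      using L[of \<alpha> \<delta>] nz that by (auto simp: A_def)
    have B: "finite B" "B \<noteq> {}" using finL ne by (auto simp: B_def)
    have less: "b < a" if "b \<in> B" "a \<in> A" for a b
    proof -
      have "b \<le> Max B" "Min A \<le> a" using that A B by auto
      then show ?thesis using \<eta>[OF \<open>\<eta> < \<alpha>\<close> \<open>\<alpha> < \<delta>\<close>] by (auto simp: A_def B_def)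
    qed
    have Un: "L \<alpha> \<beta> = B \<union> A"
      using Lun[OF nz, of \<delta> \<beta>] less that \<open>\<delta> \<le> \<beta>\<close> by (auto simp: set_less_def A_def B_def)
    define pr where "pr \<xi> = Max {\<zeta> \<in> A. \<zeta> < \<xi>}" for \<xi>
    define OA where "OA = {\<xi> \<in> A - {Min A}. e \<alpha> (pr \<xi>) = e \<delta> (pr \<xi>) \<and> e \<alpha> \<xi> > e \<delta> \<xi>}"
    define OB where "OB = {\<xi> \<in> L \<alpha> \<beta> - {Min (L \<alpha> \<beta>)}.
       (let \<xi>' = Max {\<zeta> \<in> L \<alpha> \<beta>. \<zeta> < \<xi>} in e \<alpha> \<xi>' = e \<beta> \<xi>' \<and> e \<alpha> \<xi> > e \<beta> \<xi>)}"
    define P where "P = {\<xi> \<in> A - {Min A}. pr \<xi> \<in> F}"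
    have gap: "pr \<xi> \<in> A" "pr \<xi> < \<xi>" "\<And>\<zeta>. \<zeta> \<in> A \<Longrightarrow> \<zeta> < \<xi> \<Longrightarrow> \<zeta> \<le> pr \<xi>" if "\<xi> \<in> A - {Min A}" for \<xi>
    proof -
      have "Min A \<in> {\<zeta> \<in> A. \<zeta> < \<xi>}"
        using that Min_in[OF A(1,2)] Min_le[OF A(1), of \<xi>] by auto
      then have "pr \<xi> \<in> {\<zeta> \<in> A. \<zeta> < \<xi>}"
        unfolding pr_def using A(1) by (intro Max_in) (simp, blast)
      then show "pr \<xi> \<in> A" "pr \<xi> < \<xi>" by auto
      show "\<zeta> \<le> pr \<xi>" if "\<zeta> \<in> A" "\<zeta> < \<xi>" for \<zeta>
        unfolding pr_def using A that by (intro Max_ge) auto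
    qed
    have "inj_on pr (A - {Min A})"
    proof (rule linorder_inj_onI)
      fix x y assume "x < y" "x \<in> A - {Min A}" "y \<in> A - {Min A}"
      then have "x \<le> pr y" "pr x < x" using gap(3)[of y x] gap(2)[of x] by auto
      then show "pr x \<noteq> pr y" by auto
    qed auto
    then have "inj_on pr P" by (rule inj_on_subset) (auto simp: P_def)
    then have cP: "card P \<le> card F"
      using finF by (intro card_inj_on_le[of pr]) (auto simp: P_def)
    have finP: "finite P" using A by (auto simp: P_def)
    \<comment> \<open>Inside \<open>A\<close>, away from its minimum, both traces have the same predecessors.\<close>
    have same: "Max {\<zeta> \<in> L \<alpha> \<beta>. \<zeta> < \<xi>} = pr \<xi>" if "\<xi> \<in> A - {Min A}" for \<xi>
    proof (rule Max_eqI)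
      show "finite {\<zeta> \<in> L \<alpha> \<beta>. \<zeta> < \<xi>}" using A B Un by auto
      show "pr \<xi> \<in> {\<zeta> \<in> L \<alpha> \<beta>. \<zeta> < \<xi>}" using gap[OF that] Un by auto
      show "\<zeta> \<le> pr \<xi>" if "\<zeta> \<in> {\<zeta> \<in> L \<alpha> \<beta>. \<zeta> < \<xi>}" for \<zeta>
      proof (cases "\<zeta> \<in> A")
        case True
        then show ?thesis using that gap(3)[OF \<open>\<xi> \<in> A - {Min A}\<close>] by simp
      next
        case False
        then have "\<zeta> \<in> B" using that Un by simp
        then show ?thesis using less gap(1)[OF \<open>\<xi> \<in> A - {Min A}\<close>] by (meson less_imp_le)
      qed
    qed
    have minne: "\<xi> \<noteq> Min (L \<alpha> \<beta>)" if "\<xi> \<in> A" for \<xi>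
    proof -
      obtain b where "b \<in> B" using B by auto
      have "Min (L \<alpha> \<beta>) \<le> b" using \<open>b \<in> B\<close> A B Un by auto
      then show ?thesis using less[OF \<open>b \<in> B\<close> that] by auto
    qed
    have agree: "e \<delta> \<xi> = e \<beta> \<xi>" if "\<xi> \<in> A" "\<xi> \<notin> F" for \<xi>
      using that A \<open>\<alpha> < \<delta>\<close> by (auto simp: F_def)
    have iff: "\<xi> \<in> OB \<longleftrightarrow> \<xi> \<in> OA" if "\<xi> \<in> A - {Min A}" "\<xi> \<notin> F" "\<xi> \<notin> P" for \<xi>
    proof -
      have \<xi>: "\<xi> \<in> A" "\<xi> \<in> L \<alpha> \<beta>" "pr \<xi> \<notin> F" using that Un by (auto simp: P_def)
      have "\<xi> \<in> OB \<longleftrightarrow> e \<alpha> (pr \<xi>) = e \<beta> (pr \<xi>) \<and> e \<alpha> \<xi> > e \<beta> \<xi>"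
        using \<xi>(2) minne[OF \<xi>(1)] by (simp add: OB_def same[OF that(1)] Let_def)
      also have "\<dots> \<longleftrightarrow> \<xi> \<in> OA"
        using that(1) agree[OF \<xi>(1) that(2)] agree[OF gap(1)[OF that(1)] \<xi>(3)] by (simp add: OA_def)
      finally show ?thesis .
    qed
    have "OB \<subseteq> B \<union> A" "OA \<subseteq> A - {Min A}" by (auto simp: OB_def OA_def Un)
    have sub1: "OB \<subseteq> OA \<union> (B \<union> {Min A} \<union> F \<union> P)"
      using iff \<open>OB \<subseteq> B \<union> A\<close> by blast
    have sub2: "OA \<subseteq> OB \<union> (B \<union> {Min A} \<union> F \<union> P)"
      using iff \<open>OA \<subseteq> A - {Min A}\<close> by blast
    have finO: "finite OA" "finite OB" using A B Un by (auto simp: OA_def OB_def)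
    have fin: "finite (B \<union> {Min A} \<union> F \<union> P)" using B finF finP by auto
    have "card (B \<union> {Min A} \<union> F \<union> P) \<le> card B + 1 + card F + card P"
      using card_Un_le[of "B \<union> {Min A} \<union> F" P] card_Un_le[of "B \<union> {Min A}" F] card_Un_le[of B "{Min A}"]
      by simp
    then have card: "int (card (B \<union> {Min A} \<union> F \<union> P)) \<le> n"
      using cP by (simp add: n_def B_def)
    have "card OB \<le> card OA + card (B \<union> {Min A} \<union> F \<union> P)"
      using card_mono[OF _ sub1] card_Un_le[of OA "B \<union> {Min A} \<union> F \<union> P"] finO fin by simp
    moreover have "card OA \<le> card OB + card (B \<union> {Min A} \<union> F \<union> P)"
      using card_mono[OF _ sub2] card_Un_le[of OB "B \<union> {Min A} \<union> F \<union> P"] finO fin by simp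
    moreover have "osc e L \<alpha> \<beta> = card OB" by (simp add: osc_def OB_def)
    moreover have "osc e L \<alpha> \<delta> = card OA"
      unfolding osc_def OA_def A_def pr_def by (simp add: Let_def)
    ultimately show ?thesis using card by linarith
  qed
  then show ?thesis using \<open>\<eta> < \<delta>\<close> by blast
qed

text \<open>
  Induction on \<open>\<delta>\<close>: at a limit, only an initial segment of smaller height remains outside the range of the
  previous estimate, which compares both \<open>\<beta>\<close> and \<open>\<gamma>\<close> with \<open>\<delta>\<close>.
\<close>
lemma osc_difference_bounded:
  fixes e :: "'a::wellorder \<Rightarrow> 'a \<Rightarrow> nat"
  assumes coh: "coherent_seq e" and lt: "lower_trace L" and "\<delta> \<le> \<beta>" "\<delta> \<le> \<gamma>"
  shows "\<exists>n. \<forall>\<alpha><\<delta>. \<bar>int (osc e L \<alpha> \<beta>) - int (osc e L \<alpha> \<gamma>)\<bar> \<le> n"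
  using assms(3,4)
proof (induction \<delta> rule: less_induct)
  case (less \<delta>)
  note IH' = less.IH
  let ?d = "\<lambda>\<alpha> \<beta> \<gamma>. \<bar>int (osc e L \<alpha> \<beta>) - int (osc e L \<alpha> \<gamma>)\<bar>"
  have IH: "\<exists>n. \<forall>\<alpha>\<le>\<eta>. ?d \<alpha> \<beta> \<gamma> \<le> n" if \<eta>: "\<eta> < \<delta>" for \<eta>
  proof -
    obtain n where "\<forall>\<alpha><\<eta>. ?d \<alpha> \<beta> \<gamma> \<le> n" using IH'[OF \<eta>] less.prems \<eta> by force
    then have "\<forall>\<alpha>\<le>\<eta>. ?d \<alpha> \<beta> \<gamma> \<le> max n (?d \<eta> \<beta> \<gamma>)"
      by (auto simp: le_max_iff_disj order_le_less)
    then show ?thesis by blast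
  qed
  show ?case
  proof (cases "limit_ord \<delta>")
    case False
    show ?thesis
    proof (cases "zero_ord \<delta>")
      case True
      then show ?thesis by (auto simp: zero_ord_def)
    next
      case nz: False
      then obtain \<eta> where "\<eta> < \<delta>" "\<forall>\<alpha><\<delta>. \<alpha> \<le> \<eta>"
        using False unfolding limit_ord_def zero_ord_def by (metis not_less)
      then show ?thesis using IH by blast
    qed
  next
    case True
    obtain \<eta> n where 1: "\<eta> < \<delta>" "\<And>\<alpha>. \<eta> < \<alpha> \<Longrightarrow> \<alpha> < \<delta> \<Longrightarrow> ?d \<alpha> \<beta> \<delta> \<le> n"
      using osc_bounded_limit[OF coh lt True \<open>\<delta> \<le> \<beta>\<close>] by blast
    obtain \<zeta> m where 2: "\<zeta> < \<delta>" "\<And>\<alpha>. \<zeta> < \<alpha> \<Longrightarrow> \<alpha> < \<delta> \<Longrightarrow> ?d \<alpha> \<gamma> \<delta> \<le> m"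
      using osc_bounded_limit[OF coh lt True \<open>\<delta> \<le> \<gamma>\<close>] by blast
    obtain k where 3: "\<forall>\<alpha>\<le>max \<eta> \<zeta>. ?d \<alpha> \<beta> \<gamma> \<le> k"
      using IH[of "max \<eta> \<zeta>"] 1(1) 2(1) by auto
    have "?d \<alpha> \<beta> \<gamma> \<le> max k (n + m)" if "\<alpha> < \<delta>" for \<alpha>
    proof (cases "\<alpha> \<le> max \<eta> \<zeta>")
      case True
      then show ?thesis using 3 by (meson max.coboundedI1)
    next
      case False
      then have "?d \<alpha> \<beta> \<delta> \<le> n" "?d \<alpha> \<gamma> \<delta> \<le> m" using 1(2)[of \<alpha>] 2(2)[of \<alpha>] that by (auto simp: not_le)
      then have "?d \<alpha> \<beta> \<gamma> \<le> n + m" by arith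
      then show ?thesis by simp
    qed
    then show ?thesis by blast
  qed
qed

section \<open>Exponents of words\<close>

text \<open>
  The coordinate \<open>\<alpha>\<close> of \<open>w\<^sub>\<beta>\<close> is \<open>z \<alpha>\<close> raised to this power.
\<close>
definition w_exp :: "('a::wellorder \<Rightarrow> 'a \<Rightarrow> nat) \<Rightarrow> 'a \<Rightarrow> 'a \<Rightarrow> int" where
  "w_exp f \<beta> \<alpha> = (if \<alpha> < \<beta> then int (f \<alpha> \<beta> + 1) else 0)"

text \<open>
  A list of pairs \<open>(\<beta>, k)\<close> stands for the product of the powers \<open>w\<^sub>\<beta> powi k\<close>.  Lists, in contrast to
  coefficient functions, make it evident that there are only countably many words over a countable set of
  letters.
\<close>
definition word_exp :: "('a::wellorder \<Rightarrow> 'a \<Rightarrow> nat) \<Rightarrow> ('a \<times> int) list \<Rightarrow> 'a \<Rightarrow> int" where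
  "word_exp f xs \<alpha> = (\<Sum>(\<beta>, k)\<leftarrow>xs. k * w_exp f \<beta> \<alpha>)"

lemma word_exp_append: "word_exp f (xs @ ys) \<alpha> = word_exp f xs \<alpha> + word_exp f ys \<alpha>"
  by (simp add: word_exp_def)

lemma word_exp_zip:
  assumes "length bs = length cs"
  shows "word_exp f (zip bs cs) \<alpha> = (\<Sum>j<length cs. cs ! j * w_exp f (bs ! j) \<alpha>)"
  using assms by (simp add: word_exp_def sum_list_sum_nth lessThan_atLeast0)

lemma sum_collected_coefficients:
  fixes h :: "'a \<Rightarrow> int"
  assumes "finite F" and "fst ` set xs \<subseteq> F"
  shows "(\<Sum>\<beta>\<in>F. (\<Sum>x\<leftarrow>xs. if fst x = \<beta> then snd x else 0) * h \<beta>) = (\<Sum>(\<beta>, k)\<leftarrow>xs. k * h \<beta>)"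
  using assms(2)
proof (induction xs)
  case (Cons x xs)
  have "(\<Sum>\<beta>\<in>F. (if fst x = \<beta> then snd x else 0) * h \<beta>) = (\<Sum>\<beta>\<in>F. if \<beta> = fst x then snd x * h \<beta> else 0)"
    by (rule sum.cong) auto
  also have "\<dots> = snd x * h (fst x)" using Cons.prems \<open>finite F\<close> by simp
  finally show ?case using Cons by (simp add: distrib_right sum.distrib case_prod_beta)
qed simp

text \<open>
  Moore's theorem speaks of finite sets enumerated increasingly, so repeated letters of a
  word are collected and the letters sorted.
\<close>
lemma word_normal_form:
  "\<exists>b cs. finite b \<and> b \<subseteq> fst ` set xs \<and> card b = length cs \<and> sum_list cs = sum_list (map snd xs)
     \<and> word_exp f xs = word_exp f (zip (sorted_list_of_set b) cs)"
proof -
  define b where "b = fst ` set xs"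
  define m where "m \<beta> = (\<Sum>x\<leftarrow>xs. if fst x = \<beta> then snd x else 0)" for \<beta>
  define cs where "cs = map m (sorted_list_of_set b)"
  have fin: "finite b" by (simp add: b_def)
  have list: "(\<Sum>\<beta>\<leftarrow>sorted_list_of_set b. h \<beta>) = (\<Sum>\<beta>\<in>b. h \<beta>)" for h :: "'a \<Rightarrow> int"
    using fin by (simp add: sum_list_distinct_conv_sum_set)
  have "word_exp f (zip (sorted_list_of_set b) cs) \<alpha> = word_exp f xs \<alpha>" for \<alpha>
  proof -
    have "word_exp f (zip bs (map m bs)) \<alpha> = (\<Sum>\<beta>\<leftarrow>bs. m \<beta> * w_exp f \<beta> \<alpha>)" for bs
      by (induction bs) (auto simp: word_exp_def)
    then have "word_exp f (zip (sorted_list_of_set b) cs) \<alpha> = (\<Sum>\<beta>\<in>b. m \<beta> * w_exp f \<beta> \<alpha>)"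
      by (simp add: cs_def list)
    also have "\<dots> = word_exp f xs \<alpha>"
      unfolding m_def word_exp_def by (rule sum_collected_coefficients) (simp_all add: b_def)
    finally show ?thesis .
  qed
  moreover have "sum_list cs = sum_list (map snd xs)"
    using sum_collected_coefficients[of b xs "\<lambda>_. 1"] fin list[of m]
    by (simp add: cs_def m_def[abs_def] b_def case_prod_unfold)
  moreover have "card b = length cs" using fin by (simp add: cs_def)
  ultimately show ?thesis using fin by (intro exI[of _ b] exI[of _ cs]) (auto simp: b_def)
qed

text \<open>
  Each letter \<open>\<beta> \<ge> \<delta>\<close> may be replaced by \<open>\<delta>\<close> at the cost of a bounded error; in particular a word with
  exponent sum \<open>0\<close> has a bounded exponent below \<open>\<delta>\<close>.
\<close>
lemma word_exp_bounded:
  fixes e :: "'a::wellorder \<Rightarrow> 'a \<Rightarrow> nat"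
  assumes coh: "coherent_seq e" and lt: "lower_trace L"
    and "\<And>\<beta> k. (\<beta>, k) \<in> set xs \<Longrightarrow> \<delta> \<le> \<beta>"
  shows "\<exists>n. \<forall>\<alpha><\<delta>. \<bar>word_exp (osc e L) xs \<alpha> - sum_list (map snd xs) * w_exp (osc e L) \<delta> \<alpha>\<bar> \<le> n"
  using assms(3)
proof (induction xs)
  case Nil
  then show ?case by (auto simp: word_exp_def)
next
  case (Cons x xs)
  obtain \<beta> k where x: "x = (\<beta>, k)" by (cases x)
  then have "\<delta> \<le> \<beta>" using Cons.prems[of \<beta> k] by simp
  obtain n where n: "\<And>\<alpha>. \<alpha> < \<delta> \<Longrightarrow> \<bar>word_exp (osc e L) xs \<alpha> - sum_list (map snd xs) * w_exp (osc e L) \<delta> \<alpha>\<bar> \<le> n"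
    using Cons.IH Cons.prems by (meson list.set_intros(2))
  obtain m where m: "\<And>\<alpha>. \<alpha> < \<delta> \<Longrightarrow> \<bar>int (osc e L \<alpha> \<beta>) - int (osc e L \<alpha> \<delta>)\<bar> \<le> m"
    using osc_difference_bounded[OF coh lt \<open>\<delta> \<le> \<beta>\<close> order_refl] by blast
  have "\<bar>word_exp (osc e L) (x # xs) \<alpha> - sum_list (map snd (x # xs)) * w_exp (osc e L) \<delta> \<alpha>\<bar> \<le> \<bar>k\<bar> * m + n"
    if "\<alpha> < \<delta>" for \<alpha>
  proof -
    let ?d = "word_exp (osc e L) xs \<alpha> - sum_list (map snd xs) * w_exp (osc e L) \<delta> \<alpha>"
    let ?e = "int (osc e L \<alpha> \<beta>) - int (osc e L \<alpha> \<delta>)"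
    have "\<alpha> < \<beta>" using that \<open>\<delta> \<le> \<beta>\<close> by simp
    then have "word_exp (osc e L) (x # xs) \<alpha> - sum_list (map snd (x # xs)) * w_exp (osc e L) \<delta> \<alpha> = k * ?e + ?d"
      using that by (simp add: x word_exp_def w_exp_def algebra_simps)
    also have "\<bar>\<dots>\<bar> \<le> \<bar>k\<bar> * \<bar>?e\<bar> + \<bar>?d\<bar>" by (metis abs_mult abs_triangle_ineq)
    also have "\<dots> \<le> \<bar>k\<bar> * m + n" using m[OF that] n[OF that] by (intro add_mono mult_left_mono) auto
    finally show ?thesis .
  qed
  then show ?case by blast
qed

section \<open>Kronecker's theorem on the circle\<close>

text \<open>
  Writing \<open>z \<alpha> = cis (2 * pi * \<phi> \<alpha>)\<close>, rational independence of the \<open>z \<alpha>\<close> says that the numbers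
  \<open>M * \<phi> \<alpha>\<close> together with \<open>1\<close> are linearly independent over the integers, which is the
  hypothesis of Kronecker's theorem.
\<close>
lemma Kronecker_circle:
  assumes z: "\<And>\<alpha>. z \<alpha> \<in> sphere 0 1" and ind: "rationally_independent z"
    and "finite A" and "M \<noteq> 0" and "\<epsilon> > 0" and v: "\<And>\<alpha>. \<alpha> \<in> A \<Longrightarrow> v \<alpha> \<in> sphere 0 1"
  shows "\<exists>k::int. \<forall>\<alpha>\<in>A. dist (z \<alpha> powi (k * M)) (v \<alpha>) < \<epsilon>"
proof -
  have "\<exists>\<phi>. z \<alpha> = cis (2 * pi * \<phi>)" for \<alpha>
  proof -
    have "z \<alpha> = cis (2 * pi * (Arg (z \<alpha>) / (2 * pi)))"
      using z[of \<alpha>] cis_Arg[of "z \<alpha>"] by (cases "z \<alpha> = 0") (auto simp: sgn_div_norm)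
    then show ?thesis by blast
  qed
  then obtain \<phi> where \<phi>: "\<And>\<alpha>. z \<alpha> = cis (2 * pi * \<phi> \<alpha>)" by metis
  have "\<exists>\<psi>. \<alpha> \<in> A \<longrightarrow> v \<alpha> = cis (2 * pi * \<psi>)" for \<alpha>
  proof (cases "\<alpha> \<in> A")
    case True
    have "v \<alpha> = cis (2 * pi * (Arg (v \<alpha>) / (2 * pi)))"
      using v[OF True] cis_Arg[of "v \<alpha>"] by (cases "v \<alpha> = 0") (auto simp: sgn_div_norm)
    then show ?thesis by blast
  qed auto
  then obtain \<psi> where \<psi>: "\<And>\<alpha>. \<alpha> \<in> A \<Longrightarrow> v \<alpha> = cis (2 * pi * \<psi> \<alpha>)" by metis
  have powi: "z \<alpha> powi p = cis (2 * pi * (of_int p * \<phi> \<alpha>))" for \<alpha> p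
    by (simp add: \<phi> cis_power_int algebra_simps)
  define n where "n = card A"
  obtain g where g: "bij_betw g {..<n} A"
    using \<open>finite A\<close> unfolding n_def by (metis ex_bij_betw_nat_finite lessThan_atLeast0)
  define \<theta> where "\<theta> i = (if i < n then of_int M * \<phi> (g i) else 1)" for i
  have key: "(\<forall>i\<le>n. u i = 0)" if "(\<Sum>i\<le>n. of_int (u i) * \<theta> i) = 0" for u :: "nat \<Rightarrow> int"
  proof -
    define p where "p \<alpha> = u (inv_into {..<n} g \<alpha>) * M" for \<alpha>
    have pg: "p (g i) = u i * M" if "i < n" for i
      using g that by (simp add: p_def bij_betw_def)
    have "(\<Prod>\<alpha>\<in>A. z \<alpha> powi p \<alpha>) = (\<Prod>i<n. z (g i) powi p (g i))"
      by (rule prod.reindex_bij_betw[OF g, symmetric])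
    also have "\<dots> = (\<Prod>i<n. cis (2 * pi * (of_int (u i) * \<theta> i)))"
      by (rule prod.cong) (auto simp: powi pg \<theta>_def algebra_simps)
    also have "\<dots> = cis (2 * pi * (\<Sum>i<n. of_int (u i) * \<theta> i))"
      by (simp add: cis_conv_exp exp_sum sum_distrib_left)
    also have "(\<Sum>i<n. of_int (u i) * \<theta> i) = - of_int (u n)"
      using that by (simp add: lessThan_Suc_atMost[symmetric] \<theta>_def)
    also have "cis (2 * pi * (- of_int (u n))) = 1"
      by (rule cis_multiple_2pi) auto
    finally have "\<forall>\<alpha>\<in>A. p \<alpha> = 0"
      using ind \<open>finite A\<close> unfolding rationally_independent_def by blast
    then have 0: "u i = 0" if "i < n" for i
      using pg[OF that] \<open>M \<noteq> 0\<close> g that by (auto simp: bij_betw_def)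
    then have "(\<Sum>i\<le>n. of_int (u i) * \<theta> i) = of_int (u n)"
      by (simp add: lessThan_Suc_atMost[symmetric] \<theta>_def)
    with that 0 show ?thesis by (metis nat_less_le of_int_eq_0_iff)
  qed
  have inj: "inj_on \<theta> {..n}"
  proof (rule inj_onI, rule ccontr)
    fix i j assume ij: "i \<in> {..n}" "j \<in> {..n}" "\<theta> i = \<theta> j" "i \<noteq> j"
    define u :: "nat \<Rightarrow> int" where "u k = (if k = i then 1 else 0) - (if k = j then 1 else 0)" for k
    have "(\<Sum>k\<le>n. of_int (u k) * \<theta> k)
        = (\<Sum>k\<le>n. if k = i then \<theta> k else 0) - (\<Sum>k\<le>n. if k = j then \<theta> k else 0)"
      unfolding sum_subtractf[symmetric] by (rule sum.cong) (auto simp: u_def)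
    also have "\<dots> = 0" using ij by simp
    finally have "u i = 0" using key ij by blast
    then show False using ij by (simp add: u_def)
  qed
  interpret Modules.module "\<lambda>r. (*) (real_of_int r)"
    by (simp add: Modules.module.intro distrib_left mult.commute)
  have indp: "independent (\<theta> ` {..n})"
  proof -
    have "\<forall>x\<in>\<theta> ` {..n}. u x = 0" if "(\<Sum>x\<in>\<theta> ` {..n}. of_int (u x) * x) = 0" for u
      using key[of "u \<circ> \<theta>"] that by (auto simp: sum.reindex[OF inj])
    then show ?thesis by (auto simp: dependent_finite)
  qed
  have "continuous_on UNIV cis" by (intro continuous_intros)
  then have "isCont cis 0" by (simp add: continuous_on_eq_continuous_at)
  then obtain \<delta> where "\<delta> > 0" and \<delta>: "\<And>x. \<bar>x\<bar> < \<delta> \<Longrightarrow> dist (cis x) 1 < \<epsilon>"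
    using \<open>\<epsilon> > 0\<close> unfolding continuous_at_eps_delta by (auto simp: dist_norm)
  obtain k m where km: "\<And>i. i < n \<Longrightarrow> \<bar>of_int k * \<theta> i - of_int (m i) - \<psi> (g i)\<bar> < \<delta> / (2 * pi)"
    using Kronecker_thm_2[OF indp inj, of "\<delta> / (2 * pi)" "\<lambda>i. \<psi> (g i)"] \<open>\<delta> > 0\<close> by (auto simp: \<theta>_def)
  have "dist (z \<alpha> powi (k * M)) (v \<alpha>) < \<epsilon>" if "\<alpha> \<in> A" for \<alpha>
  proof -
    have "\<alpha> \<in> g ` {..<n}" using bij_betw_imp_surj_on[OF g] that by simp
    then obtain i where i: "i < n" "\<alpha> = g i" by auto
    define x where "x = 2 * pi * (of_int k * \<theta> i - of_int (m i) - \<psi> (g i))"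
    have "\<bar>x\<bar> < \<delta>"
      using km[OF i(1)] unfolding x_def abs_mult by (simp add: pos_less_divide_eq mult.commute)
    have "cis (2 * pi * of_int (m i)) = 1"
      by (rule cis_multiple_2pi) auto
    moreover have "2 * pi * (of_int (k * M) * \<phi> \<alpha>) = x + 2 * pi * \<psi> \<alpha> + 2 * pi * of_int (m i)"
    proof -
      have "of_int M * \<phi> \<alpha> = \<theta> i" using i by (simp add: \<theta>_def)
      then have "of_int (k * M) * \<phi> \<alpha> = of_int k * \<theta> i" by (metis mult.assoc of_int_mult)
      then show ?thesis unfolding x_def i(2) by (simp only: right_diff_distrib)
    qed
    ultimately have "z \<alpha> powi (k * M) = cis x * v \<alpha>"
      unfolding powi \<psi>[OF that] by (metis cis_mult mult.right_neutral)
    then have "dist (z \<alpha> powi (k * M)) (v \<alpha>) = norm ((cis x - 1) * v \<alpha>)"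
      by (simp add: dist_norm algebra_simps)
    also have "\<dots> = dist (cis x) 1"
      using v[OF that] by (simp add: norm_mult dist_norm)
    finally show ?thesis using \<delta>[OF \<open>\<bar>x\<bar> < \<delta>\<close>] by simp
  qed
  then show ?thesis by blast
qed

text \<open>
  By total boundedness of the finite-dimensional torus, finitely many exponents serve all targets \<open>v\<close>.  The
  uniform bound matters because the length of the progression asked from Moore's theorem has to be fixed
  before the points \<open>z \<alpha>\<close> and the target are known.
\<close>
lemma Kronecker_circle_uniform:
  assumes z: "\<And>\<alpha>. z \<alpha> \<in> sphere 0 1" and ind: "rationally_independent z"
    and "finite A" and "M \<noteq> 0" and "\<epsilon> > 0"
  shows "\<exists>N. \<forall>v \<in> A \<rightarrow> sphere 0 1. \<exists>t<N. \<forall>\<alpha>\<in>A. dist (z \<alpha> powi (int t * M)) (v \<alpha>) < \<epsilon>"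
proof -
  have "\<exists>F. finite F \<and> F \<subseteq> sphere 0 1 \<and> sphere (0::complex) 1 \<subseteq> (\<Union>x\<in>F. ball x (\<epsilon> / 2))"
    by (rule seq_compact_imp_totally_bounded[OF compact_imp_seq_compact[OF compact_sphere], rule_format])
      (use \<open>\<epsilon> > 0\<close> in simp)
  then obtain F :: "complex set" where F: "finite F" "F \<subseteq> sphere 0 1" 
    "sphere 0 1 \<subseteq> (\<Union>x\<in>F. ball x (\<epsilon> / 2))" by blast
  have "\<forall>v \<in> A \<rightarrow>\<^sub>E F. \<exists>k. \<forall>\<alpha>\<in>A. dist (z \<alpha> powi (k * M)) (v \<alpha>) < \<epsilon> / 2"
    using Kronecker_circle[OF z ind \<open>finite A\<close> \<open>M \<noteq> 0\<close>, of "\<epsilon> / 2"] F(2) \<open>\<epsilon> > 0\<close>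
    by (meson PiE_mem half_gt_zero subset_iff)
  then have "\<exists>k. \<forall>v \<in> A \<rightarrow>\<^sub>E F. \<forall>\<alpha>\<in>A. dist (z \<alpha> powi (k v * M)) (v \<alpha>) < \<epsilon> / 2"
    by (rule bchoice)
  then obtain k where k: "\<And>v \<alpha>. v \<in> A \<rightarrow>\<^sub>E F \<Longrightarrow> \<alpha> \<in> A \<Longrightarrow> dist (z \<alpha> powi (k v * M)) (v \<alpha>) < \<epsilon> / 2"
    by blast
  have fin: "finite (A \<rightarrow>\<^sub>E F)" using \<open>finite A\<close> F(1) by (simp add: finite_PiE)
  define R where "R = Max (insert 0 ((\<lambda>v. \<bar>k v\<bar>) ` (A \<rightarrow>\<^sub>E F)))"
  have R: "\<bar>k v\<bar> \<le> R" if "v \<in> A \<rightarrow>\<^sub>E F" for v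
    unfolding R_def using fin that by (intro Max_ge) auto
  have "R \<ge> 0" unfolding R_def using fin by (intro Max_ge) auto
  \<comment> \<open>The exponents found lie in \<open>[-R, R]\<close>; multiplying the target by \<open>z powi (- R * M)\<close> first makes
    them nonnegative.\<close>
  have "\<exists>t<nat (2 * R + 1). \<forall>\<alpha>\<in>A. dist (z \<alpha> powi (int t * M)) (v \<alpha>) < \<epsilon>"
    if v: "v \<in> A \<rightarrow> sphere 0 1" for v
  proof -
    have nz: "z \<alpha> \<noteq> 0" "norm (z \<alpha>) = 1" for \<alpha> using z[of \<alpha>] by auto
    have "v \<alpha> * z \<alpha> powi (- R * M) \<in> sphere 0 1" if "\<alpha> \<in> A" for \<alpha>
      using v that by (auto simp: norm_mult norm_power_int nz)
    then have "\<forall>\<alpha>\<in>A. \<exists>x\<in>F. dist x (v \<alpha> * z \<alpha> powi (- R * M)) < \<epsilon> / 2"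
      using F(3) by (fastforce simp: subset_iff)
    then obtain u where "\<forall>\<alpha>\<in>A. u \<alpha> \<in> F \<and> dist (u \<alpha>) (v \<alpha> * z \<alpha> powi (- R * M)) < \<epsilon> / 2"
      using bchoice[of A "\<lambda>\<alpha> x. x \<in> F \<and> dist x (v \<alpha> * z \<alpha> powi (- R * M)) < \<epsilon> / 2"] by auto
    then have u: "u \<alpha> \<in> F" "dist (u \<alpha>) (v \<alpha> * z \<alpha> powi (- R * M)) < \<epsilon> / 2" if "\<alpha> \<in> A" for \<alpha>
      using that by auto
    define u' where "u' = restrict u A"
    have u': "u' \<in> A \<rightarrow>\<^sub>E F" using u(1) unfolding u'_def by simp
    define t where "t = nat (k u' + R)"
    have t: "int t = k u' + R" "t < nat (2 * R + 1)" using R[OF u'] unfolding t_def by auto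
    have "dist (z \<alpha> powi (int t * M)) (v \<alpha>) < \<epsilon>" if "\<alpha> \<in> A" for \<alpha>
    proof -
      have "dist (z \<alpha> powi (k u' * M)) (u \<alpha>) < \<epsilon> / 2"
        using k[OF u' that] that by (simp add: u'_def)
      then have *: "dist (z \<alpha> powi (k u' * M)) (v \<alpha> * z \<alpha> powi (- R * M)) < \<epsilon>"
        using u(2)[OF that] dist_triangle_half_r[of _ _ \<epsilon>] by (metis dist_commute)
      have "dist (z \<alpha> powi (k u' * M)) (v \<alpha> * z \<alpha> powi (- R * M))
          = norm (z \<alpha> powi (R * M)) * dist (z \<alpha> powi (k u' * M)) (v \<alpha> * z \<alpha> powi (- R * M))"
        by (simp add: norm_power_int nz)
      also have "\<dots> = norm (z \<alpha> powi (R * M) * (z \<alpha> powi (k u' * M) - v \<alpha> * z \<alpha> powi (- R * M)))"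
        by (simp add: dist_norm norm_mult)
      also have "z \<alpha> powi (R * M) * (z \<alpha> powi (k u' * M) - v \<alpha> * z \<alpha> powi (- R * M))
          = z \<alpha> powi (R * M + k u' * M) - v \<alpha> * z \<alpha> powi (R * M + - R * M)"
        by (simp add: power_int_add nz right_diff_distrib power_int_minus)
      also have "R * M + k u' * M = int t * M" by (simp add: t algebra_simps)
      finally show ?thesis using * by (simp add: dist_norm)
    qed
    then show ?thesis using t by blast
  qed
  then show ?thesis by blast
qed

lemma dist_powi_shift:
  fixes z :: complex
  assumes "norm z = 1"
  shows "dist (z powi a) (z powi (b + c)) = dist (z powi (a - b)) (z powi c)"
proof -
  have "z \<noteq> 0" using assms by auto
  have "dist (z powi a) (z powi (b + c)) = norm (z powi b * (z powi (a - b) - z powi c))"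
    using \<open>z \<noteq> 0\<close> by (simp add: dist_norm right_diff_distrib flip: power_int_add)
  also have "\<dots> = dist (z powi (a - b)) (z powi c)"
    using assms by (simp add: norm_mult norm_power_int dist_norm)
  finally show ?thesis .
qed

section \<open>Uncountable families\<close>

lemma omega1_countable_bounded:
  fixes S :: "'a::wellorder set"
  assumes "is_omega1 TYPE('a)" and "countable S"
  shows "\<exists>\<delta>. \<forall>x\<in>S. x < \<delta>"
proof (rule ccontr)
  assume "\<not> ?thesis"
  then have "\<forall>\<delta>. \<exists>x\<in>S. \<delta> \<le> x" by (simp add: not_less)
  then have "(UNIV :: 'a set) \<subseteq> (\<Union>x\<in>S. insert x {..<x})" by (auto simp: order_le_less)
  moreover have "countable (\<Union>x\<in>S. insert x {..<x})"
    using assms by (intro countable_UN) (auto simp: is_omega1_def)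
  ultimately show False
    using assms(1) countable_subset unfolding is_omega1_def by blast
qed

text \<open>
  The supremum of an \<open>\<omega>\<close>-sequence, each of whose members bounds all sets \<open>F \<eta>\<close> for \<open>\<eta>\<close> up to
  the previous member, is closed.
\<close>
lemma omega1_closed_point:
  fixes F :: "'a::wellorder \<Rightarrow> 'a set"
  assumes om: "is_omega1 TYPE('a)" and F: "\<And>\<eta>. countable (F \<eta>)"
  shows "\<exists>\<delta>>\<gamma>. \<forall>\<eta><\<delta>. F \<eta> \<subseteq> {..<\<delta>}"
proof -
  have "\<exists>y. x < y \<and> (\<forall>\<eta>\<le>x. F \<eta> \<subseteq> {..<y})" for x
  proof -
    have "countable (insert x (\<Union>\<eta>\<in>insert x {..<x}. F \<eta>))"
      using om F by (auto simp: is_omega1_def)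
    then obtain y where "\<forall>u\<in>insert x (\<Union>\<eta>\<in>insert x {..<x}. F \<eta>). u < y"
      using omega1_countable_bounded[OF om] by blast
    then show ?thesis by (intro exI[of _ y]) (auto simp: order_le_less)
  qed
  then obtain g where g: "\<And>x. x < g x" "\<And>x \<eta>. \<eta> \<le> x \<Longrightarrow> F \<eta> \<subseteq> {..<g x}"
    by metis
  define d where "d n = (g ^^ n) \<gamma>" for n
  define \<delta> where "\<delta> = (LEAST y. \<forall>n. d n < y)"
  have "\<exists>y. \<forall>n. d n < y"
    using omega1_countable_bounded[OF om, of "range d"] by auto
  then have "\<forall>n. d n < \<delta>" unfolding \<delta>_def by (rule LeastI_ex)
  then have \<delta>: "d n < \<delta>" for n by blast
  have "F \<eta> \<subseteq> {..<\<delta>}" if "\<eta> < \<delta>" for \<eta>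
  proof -
    have "\<not> (\<forall>n. d n < \<eta>)" using that not_less_Least unfolding \<delta>_def by blast
    then obtain n where "\<eta> \<le> d n" by (auto simp: not_less)
    then have "F \<eta> \<subseteq> {..<d (Suc n)}" using g(2) by (simp add: d_def)
    then show ?thesis using \<delta>[of "Suc n"] by auto
  qed
  moreover have "\<gamma> < \<delta>" using \<delta>[of 0] by (simp add: d_def)
  ultimately show ?thesis by blast
qed

lemma omega1_closed_under_words:
  fixes F :: "('a::wellorder \<times> int) list \<Rightarrow> 'c::countable \<Rightarrow> 'a set"
  assumes om: "is_omega1 TYPE('a)" and F: "\<And>xs c. countable (F xs c)"
  shows "\<exists>\<delta>. \<forall>xs\<in>lists ({..<\<delta>} \<times> UNIV). \<forall>c. F xs c \<subseteq> {..<\<delta>}"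
proof -
  have "countable (\<Union>xs\<in>lists ({..\<eta>} \<times> UNIV). \<Union>c. F xs c)" for \<eta>
  proof -
    have "{..\<eta>} = insert \<eta> {..<\<eta>}" by auto
    then have "countable {..\<eta>}" using om by (simp add: is_omega1_def)
    then have "countable ({..\<eta>} \<times> (UNIV :: int set))" by (intro countable_SIGMA) auto
    then show ?thesis using F by (intro countable_UN countable_lists) auto
  qed
  then obtain \<gamma> \<delta> where "\<gamma> < \<delta>"
    and \<delta>: "\<And>\<eta>. \<eta> < \<delta> \<Longrightarrow> (\<Union>xs\<in>lists ({..\<eta>} \<times> UNIV). \<Union>c. F xs c) \<subseteq> {..<\<delta>}"
    using omega1_closed_point[OF om, of "\<lambda>\<eta>. \<Union>xs\<in>lists ({..\<eta>} \<times> UNIV). \<Union>c. F xs c"] by blast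
  have "F xs c \<subseteq> {..<\<delta>}" if xs: "xs \<in> lists ({..<\<delta>} \<times> UNIV)" for xs c
  proof -
    define \<eta> where "\<eta> = Max (insert \<gamma> (fst ` set xs))"
    have "fst ` set xs \<subseteq> {..<\<delta>}" using xs by (auto simp: in_lists_conv_set)
    then have "\<eta> < \<delta>" using \<open>\<gamma> < \<delta>\<close> by (auto simp: \<eta>_def)
    have "xs \<in> lists ({..\<eta>} \<times> UNIV)"
    proof -
      have "fst x \<le> \<eta>" if "x \<in> set xs" for x
        unfolding \<eta>_def using that by (intro Max_ge) auto
      then show ?thesis by (auto simp: in_lists_conv_set)
    qed
    then show ?thesis using \<delta>[OF \<open>\<eta> < \<delta>\<close>] by blast
  qed
  then show ?thesis by blast
qed

lemma uncountable_fibre: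
  fixes h :: "'i \<Rightarrow> 'c::countable"
  assumes "uncountable I"
  shows "\<exists>c. uncountable {i \<in> I. h i = c}"
proof (rule ccontr)
  assume "\<not> ?thesis"
  then have "countable (\<Union>c. {i \<in> I. h i = c})" by (intro countable_UN) auto
  moreover have "(\<Union>c. {i \<in> I. h i = c}) = I" by auto
  ultimately show False using assms by simp
qed

text \<open>
  A maximal disjoint subfamily is uncountable: a countable one would meet only countably many
  members of the family.
\<close>
lemma uncountable_disjoint_subfamily:
  assumes I: "uncountable I" and fin: "\<And>i. i \<in> I \<Longrightarrow> finite (a i)"
    and small: "\<And>x. countable {i \<in> I. x \<in> a i}"
  shows "\<exists>J\<subseteq>I. uncountable J \<and> (\<forall>i\<in>J. \<forall>j\<in>J. i \<noteq> j \<longrightarrow> a i \<inter> a j = {})"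
proof -
  define P where "P = {J. J \<subseteq> I \<and> (\<forall>i\<in>J. \<forall>j\<in>J. i \<noteq> j \<longrightarrow> a i \<inter> a j = {})}"
  have "\<exists>M\<in>P. \<forall>J\<in>P. M \<subseteq> J \<longrightarrow> J = M"
  proof (rule subset_Zorn')
    fix C assume C: "subset.chain P C"
    show "\<Union>C \<in> P"
    proof -
      have CP: "C \<subseteq> P" using C by (simp add: subset_chain_def)
      have "a i \<inter> a j = {}" if "i \<in> S" "S \<in> C" "j \<in> T" "T \<in> C" "i \<noteq> j" for i j S T
      proof -
        have "S \<subseteq> T \<or> T \<subseteq> S" using C that by (auto simp: subset_chain_def)
        then have "\<exists>U\<in>C. i \<in> U \<and> j \<in> U" using that by blast
        then obtain U where "U \<in> P" "i \<in> U" "j \<in> U" using CP by blast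
        then show ?thesis using \<open>i \<noteq> j\<close> unfolding P_def by blast
      qed
      then show ?thesis using CP by (auto simp: P_def)
    qed
  qed
  then obtain J where J: "J \<in> P" and max: "\<And>J'. J' \<in> P \<Longrightarrow> J \<subseteq> J' \<Longrightarrow> J' = J" by blast
  have "uncountable J"
  proof
    assume "countable J"
    define S where "S = J \<union> (\<Union>x\<in>(\<Union>i\<in>J. a i). {i \<in> I. x \<in> a i})"
    have cJ: "countable (\<Union>i\<in>J. a i)"
      using \<open>countable J\<close> fin J by (intro countable_UN) (auto simp: P_def countable_finite)
    have "countable S" unfolding S_def
      using small \<open>countable J\<close> by (intro countable_Un countable_UN[OF cJ]) auto
    then obtain i where i: "i \<in> I" "i \<notin> S" using I countable_subset[of I S] by blast
    then have "insert i J \<in> P" using J by (auto simp: P_def S_def)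
    then have "insert i J = J" using max by blast
    then show False using i by (auto simp: S_def)
  qed
  then show ?thesis using J by (auto simp: P_def)
qed

text \<open>
  The delta system lemma for sets of constant size.  Either some point lies in uncountably many of
  the sets and can be removed from them to lower their size, or the previous lemma applies with
  empty root.
\<close>
lemma delta_system:
  assumes "uncountable I" and "\<forall>i\<in>I. finite (a i) \<and> card (a i) = k"
  shows "\<exists>J D. J \<subseteq> I \<and> uncountable J \<and> finite D \<and> (\<forall>i\<in>J. D \<subseteq> a i)
            \<and> (\<forall>i\<in>J. \<forall>j\<in>J. i \<noteq> j \<longrightarrow> a i \<inter> a j = D)"
  using assms
proof (induction k arbitrary: I a rule: less_induct)
  case (less k)
  have fin: "finite (a i)" and card: "card (a i) = k" if "i \<in> I" for i
    using less.prems(2) that by auto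
  show ?case
  proof (cases "\<exists>x. uncountable {i \<in> I. x \<in> a i}")
    case False
    then obtain J where "J \<subseteq> I" "uncountable J" "\<forall>i\<in>J. \<forall>j\<in>J. i \<noteq> j \<longrightarrow> a i \<inter> a j = {}"
      using uncountable_disjoint_subfamily[of I a] less.prems(1) fin by metis
    then show ?thesis by (intro exI[of _ J] exI[of _ "{}"]) auto
  next
    case True
    then obtain x where x: "uncountable {i \<in> I. x \<in> a i}" by blast
    define I' where "I' = {i \<in> I. x \<in> a i}"
    have unc: "uncountable I'" using x by (simp add: I'_def)
    have "I' \<noteq> {}" using unc by auto
    then obtain i where "i \<in> I" "x \<in> a i" by (auto simp: I'_def)
    then have "k > 0" using fin[of i] card[of i] card_gt_0_iff[of "a i"] by auto
    then have "k - 1 < k" by simp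
    have prem: "\<forall>i\<in>I'. finite (a i - {x}) \<and> card (a i - {x}) = k - 1"
      using fin card by (auto simp: I'_def)
    obtain J D where J: "J \<subseteq> I'" "uncountable J" "finite D" "\<forall>i\<in>J. D \<subseteq> a i - {x}"
      "\<forall>i\<in>J. \<forall>j\<in>J. i \<noteq> j \<longrightarrow> (a i - {x}) \<inter> (a j - {x}) = D"
      using less.IH[OF \<open>k - 1 < k\<close> unc prem] by (elim exE conjE) (rule that)
    have "a i \<inter> a j = insert x D" if "i \<in> J" "j \<in> J" "i \<noteq> j" for i j
    proof -
      have "x \<in> a i" "x \<in> a j" using that J(1) by (auto simp: I'_def)
      moreover have "(a i - {x}) \<inter> (a j - {x}) = D" using J(5) that by blast
      ultimately show ?thesis by blast
    qed
    moreover have "insert x D \<subseteq> a i" if "i \<in> J" for i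
      using that J(1,4) by (auto simp: I'_def)
    moreover have "J \<subseteq> I" using J(1) by (auto simp: I'_def)
    ultimately show ?thesis using J(2,3) by (intro exI[of _ J] exI[of _ "insert x D"]) simp
  qed
qed

section \<open>Approximation of words by words with smaller letters\<close>

text \<open>
  The core of the argument, a contradiction from bad tails \<open>b \<gamma>\<close> at all stages \<open>\<gamma>\<close>.  For \<open>\<gamma> < \<gamma>'\<close> in a
  suitable uncountable set, the word of \<open>b \<gamma>\<close> is a candidate for approximating that of \<open>b \<gamma>'\<close> and must
  fail, whereas Moore's theorem and Kronecker's theorem produce a pair for which it succeeds.  The
  nonzero sum of \<open>cs\<close> is the difference of the progression of exponents to which Kronecker's theorem is
  applied.  The prefix \<open>xs\<close> contributes the same exponent to all these words and cancels.
\<close>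
lemma word_approximation:
  fixes f :: "'a::wellorder \<Rightarrow> 'a \<Rightarrow> nat" and xs :: "('a \<times> int) list"
  assumes om: "is_omega1 TYPE('a)" and moore: "moore_property f"
    and z: "\<And>\<alpha>. z \<alpha> \<in> sphere 0 1" and ind: "rationally_independent z"
    and xs: "xs \<in> lists (X \<times> UNIV)" and M: "sum_list cs \<noteq> 0"
    and A: "\<And>ys. finite (A ys)" and \<epsilon>: "\<And>ys. \<epsilon> ys > 0"
  shows "\<exists>\<gamma>. \<forall>b. finite b \<and> b \<subseteq> X \<inter> {\<gamma>..} \<and> card b = length cs \<longrightarrow>
           (\<exists>ys\<in>lists ((X \<inter> {..<\<gamma>}) \<times> UNIV). \<forall>\<alpha>\<in>A ys.
              dist (z \<alpha> powi word_exp f ys \<alpha>)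
                   (z \<alpha> powi word_exp f (xs @ zip (sorted_list_of_set b) cs) \<alpha>) < \<epsilon> ys)"
proof (rule ccontr)
  define l where "l = length cs"
  define Y where "Y b = xs @ zip (sorted_list_of_set b) cs" for b
  define W where "W b = word_exp f (Y b)" for b
  define near where "near \<gamma> b \<longleftrightarrow> (\<exists>ys\<in>lists ((X \<inter> {..<\<gamma>}) \<times> UNIV). \<forall>\<alpha>\<in>A ys.
      dist (z \<alpha> powi word_exp f ys \<alpha>) (z \<alpha> powi W b \<alpha>) < \<epsilon> ys)" for \<gamma> b
  assume "\<not> ?thesis"
  then have "\<not> (\<exists>\<gamma>. \<forall>b. finite b \<and> b \<subseteq> X \<inter> {\<gamma>..} \<and> card b = l \<longrightarrow> near \<gamma> b)"
    unfolding near_def W_def Y_def l_def .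
  then have "\<forall>\<gamma>. \<exists>b. finite b \<and> b \<subseteq> X \<inter> {\<gamma>..} \<and> card b = l \<and> \<not> near \<gamma> b" by blast
  from choice[OF this] obtain b where
    b: "\<And>\<gamma>. finite (b \<gamma>)" "\<And>\<gamma>. b \<gamma> \<subseteq> X \<inter> {\<gamma>..}" "\<And>\<gamma>. card (b \<gamma>) = l"
    and bad: "\<And>\<gamma>. \<not> near \<gamma> (b \<gamma>)"
    by blast
  have "l > 0" using M by (auto simp: l_def)
  then have bne: "b \<gamma> \<noteq> {}" for \<gamma> using b(3)[of \<gamma>] by auto
  have Minb: "Min (b \<gamma>) \<in> b \<gamma>" for \<gamma> using b(1) bne by simp
  have Y: "length (sorted_list_of_set (b \<gamma>)) = length cs" for \<gamma> using b(1,3) by (simp add: l_def)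

  have "countable (fst ` set xs)" by (simp add: countable_finite)
  then obtain \<gamma>0 where \<gamma>0: "\<forall>x\<in>fst ` set xs. x < \<gamma>0"
    using omega1_countable_bounded[OF om] by blast
  \<comment> \<open>For indices in the set \<open>C\<close> of closed points, the sets \<open>b \<gamma>\<close> follow one another in blocks.\<close>
  define C where "C = {\<delta>. \<gamma>0 < \<delta> \<and> (\<forall>\<eta><\<delta>. b \<eta> \<subseteq> {..<\<delta>})}"
  have "uncountable C"
  proof
    assume "countable C"
    then obtain \<delta> where \<delta>: "\<forall>x\<in>C. x < \<delta>" using omega1_countable_bounded[OF om] by blast
    obtain \<delta>' where "\<delta>' > max \<delta> \<gamma>0" "\<forall>\<eta><\<delta>'. b \<eta> \<subseteq> {..<\<delta>'}"
      using omega1_closed_point[OF om, of b "max \<delta> \<gamma>0"] b(1) countable_finite by blast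
    then have "\<delta>' \<in> C" "\<delta> < \<delta>'" by (auto simp: C_def)
    then show False using \<delta> by auto
  qed
  have sep: "x < y" if "\<gamma> < \<gamma>'" "\<gamma>' \<in> C" "x \<in> b \<gamma>" "y \<in> b \<gamma>'" for \<gamma> \<gamma>' x y
  proof -
    have "x < \<gamma>'" using that by (auto simp: C_def)
    moreover have "\<gamma>' \<le> y" using b(2) that by auto
    ultimately show ?thesis by simp
  qed
  have disj: "b \<gamma> \<inter> b \<gamma>' = {}" if "\<gamma> \<in> C" "\<gamma>' \<in> C" "\<gamma> \<noteq> \<gamma>'" for \<gamma> \<gamma>'
  proof (rule ccontr)
    assume "b \<gamma> \<inter> b \<gamma>' \<noteq> {}"
    then obtain x where "x \<in> b \<gamma>" "x \<in> b \<gamma>'" by blast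
    then have "x < x" using sep[of \<gamma> \<gamma>' x x] sep[of \<gamma>' \<gamma> x x] that by (meson linorder_neqE)
    then show False by simp
  qed

  \<comment> \<open>Adding \<open>Min (b \<gamma>)\<close> to the support makes \<open>a \<gamma> - D < b \<gamma>'\<close> force \<open>\<gamma> < \<gamma>'\<close>.\<close>
  define a where "a \<gamma> = insert (Min (b \<gamma>)) (A (Y (b \<gamma>)))" for \<gamma>
  have fina: "finite (a \<gamma>)" for \<gamma> using A by (simp add: a_def)
  have "\<exists>N. \<forall>v \<in> a \<gamma> \<rightarrow> sphere 0 1. \<exists>t<N. \<forall>\<alpha>\<in>a \<gamma>.
          dist (z \<alpha> powi (int t * sum_list cs)) (v \<alpha>) < \<epsilon> (Y (b \<gamma>))" for \<gamma>
    by (rule Kronecker_circle_uniform[OF z ind fina M \<epsilon>])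
  then obtain N where N: "\<And>\<gamma> v. v \<in> a \<gamma> \<rightarrow> sphere 0 1 \<Longrightarrow> \<exists>t<N \<gamma>. \<forall>\<alpha>\<in>a \<gamma>.
          dist (z \<alpha> powi (int t * sum_list cs)) (v \<alpha>) < \<epsilon> (Y (b \<gamma>))" by metis

  \<comment> \<open>The size of the support and the length of the progression become constant by thinning out,
    then the supports form a delta system, and finally the integer exponents on its root are constant.\<close>
  obtain kn where kn: "uncountable {\<gamma>\<in>C. (card (a \<gamma>), N \<gamma>) = kn}"
    using uncountable_fibre[OF \<open>uncountable C\<close>, of "\<lambda>\<gamma>. (card (a \<gamma>), N \<gamma>)"] by blast
  define k where "k = fst kn"
  define n where "n = snd kn"
  define C1 where "C1 = {\<gamma>\<in>C. (card (a \<gamma>), N \<gamma>) = kn}"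
  have C1: "uncountable C1" using kn unfolding C1_def .
  have carda: "\<forall>\<gamma>\<in>C1. finite (a \<gamma>) \<and> card (a \<gamma>) = k"
    using fina by (auto simp: C1_def k_def)
  obtain C2 D where C2: "C2 \<subseteq> C1" "uncountable C2" "finite D" "\<forall>\<gamma>\<in>C2. D \<subseteq> a \<gamma>"
      "\<forall>\<gamma>\<in>C2. \<forall>\<gamma>'\<in>C2. \<gamma> \<noteq> \<gamma>' \<longrightarrow> a \<gamma> \<inter> a \<gamma>' = D"
    using delta_system[OF C1 carda] by (elim exE conjE) (rule that)
  define C3 where "C3 = C2 - {\<gamma>\<in>C2. Min (b \<gamma>) \<in> D}"
  have "inj_on (\<lambda>\<gamma>. Min (b \<gamma>)) C"
  proof (rule inj_onI, rule ccontr)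
    fix \<gamma> \<gamma>' assume "\<gamma> \<in> C" "\<gamma>' \<in> C" "Min (b \<gamma>) = Min (b \<gamma>')" "\<gamma> \<noteq> \<gamma>'"
    then show False using disj[of \<gamma> \<gamma>'] Minb[of \<gamma>] Minb[of \<gamma>'] by auto
  qed
  moreover have "{\<gamma>\<in>C2. Min (b \<gamma>) \<in> D} \<subseteq> C" using C2(1) by (auto simp: C1_def)
  ultimately have "inj_on (\<lambda>\<gamma>. Min (b \<gamma>)) {\<gamma>\<in>C2. Min (b \<gamma>) \<in> D}" by (rule inj_on_subset)
  then have "finite {\<gamma>\<in>C2. Min (b \<gamma>) \<in> D}"
    by (rule inj_on_finite[OF _ _ \<open>finite D\<close>]) auto
  then have "uncountable C3"
    unfolding C3_def using C2(2) countable_finite uncountable_minus_countable by blast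
  obtain c where c: "uncountable {\<gamma>\<in>C3. map (W (b \<gamma>)) (sorted_list_of_set D) = c}"
    using uncountable_fibre[OF \<open>uncountable C3\<close>, of "\<lambda>\<gamma>. map (W (b \<gamma>)) (sorted_list_of_set D)"] by blast
  define C4 where "C4 = {\<gamma>\<in>C3. map (W (b \<gamma>)) (sorted_list_of_set D) = c}"
  have C4: "uncountable C4" "C4 \<subseteq> C" and C4D: "\<And>\<gamma>. \<gamma> \<in> C4 \<Longrightarrow> D \<subseteq> a \<gamma>"
    and NC4: "\<And>\<gamma>. \<gamma> \<in> C4 \<Longrightarrow> N \<gamma> = n" and cardC4: "\<And>\<gamma>. \<gamma> \<in> C4 \<Longrightarrow> card (a \<gamma>) = k"
    and MinC4: "\<And>\<gamma>. \<gamma> \<in> C4 \<Longrightarrow> Min (b \<gamma>) \<in> a \<gamma> - D"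
    using c C2 by (auto simp: C4_def C3_def C1_def k_def n_def a_def)
  have root: "W (b \<gamma>) \<alpha> = W (b \<gamma>') \<alpha>" if "\<gamma> \<in> C4" "\<gamma>' \<in> C4" "\<alpha> \<in> D" for \<gamma> \<gamma>' \<alpha>
  proof -
    have "map (W (b \<gamma>)) (sorted_list_of_set D) = map (W (b \<gamma>')) (sorted_list_of_set D)"
      using that by (simp add: C4_def)
    then show ?thesis using that(3) \<open>finite D\<close> by (auto simp: map_eq_conv)
  qed
  have disja: "(a \<gamma> - D) \<inter> (a \<gamma>' - D) = {}" if "\<gamma> \<in> C4" "\<gamma>' \<in> C4" "\<gamma> \<noteq> \<gamma>'" for \<gamma> \<gamma>'
    using C2(5) that by (auto simp: C4_def C3_def)

  define \<A> where "\<A> = (\<lambda>\<gamma>. a \<gamma> - D) ` C4"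
  define \<B> where "\<B> = b ` C4"
  have "inj_on (\<lambda>\<gamma>. a \<gamma> - D) C4"
  proof (rule inj_onI, rule ccontr)
    fix \<gamma> \<gamma>' assume "\<gamma> \<in> C4" "\<gamma>' \<in> C4" "a \<gamma> - D = a \<gamma>' - D" "\<gamma> \<noteq> \<gamma>'"
    then show False using disja[of \<gamma> \<gamma>'] MinC4[of \<gamma>] by auto
  qed
  then have \<A>: "uncountable \<A>" unfolding \<A>_def using C4(1) countable_image_inj_on by blast
  have "inj_on b C4"
  proof (rule inj_onI, rule ccontr)
    fix \<gamma> \<gamma>' assume "\<gamma> \<in> C4" "\<gamma>' \<in> C4" "b \<gamma> = b \<gamma>'" "\<gamma> \<noteq> \<gamma>'"
    then show False using disj[of \<gamma> \<gamma>'] bne[of \<gamma>] C4(2) by auto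
  qed
  then have \<B>: "uncountable \<B>" unfolding \<B>_def using C4(1) countable_image_inj_on by blast
  have "\<A> \<subseteq> k_subsets (k - card D)"
    using C4D cardC4 fina \<open>finite D\<close> by (auto simp: \<A>_def k_subsets_def card_Diff_subset)
  moreover have "\<B> \<subseteq> k_subsets l" using b by (auto simp: \<B>_def k_subsets_def)
  moreover have "pairwise disjnt \<A>"
    unfolding \<A>_def pairwise_def disjnt_def using disja by blast
  moreover have "pairwise disjnt \<B>"
    unfolding \<B>_def pairwise_def disjnt_def using disj C4(2) by blast
  ultimately obtain a0 b' where a0: "a0 \<in> \<A>" and b': "\<forall>m<n. b' m \<in> \<B>"
    and osc: "\<forall>i<k - card D. \<forall>j<l. \<forall>m<n. set_less a0 (b' m) \<and>
        f (sorted_list_of_set a0 ! i) (sorted_list_of_set (b' m) ! j) =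
        f (sorted_list_of_set a0 ! i) (sorted_list_of_set (b' 0) ! j) + m"
    using moore[unfolded moore_property_def, rule_format, of \<A> "k - card D" \<B> l n] \<A> \<B> by blast
  obtain \<gamma> where \<gamma>: "\<gamma> \<in> C4" "a0 = a \<gamma> - D" using a0 by (auto simp: \<A>_def)
  have "\<forall>m. \<exists>g. m < n \<longrightarrow> g \<in> C4 \<and> b' m = b g" using b' by (auto simp: \<B>_def)
  then obtain g where g: "\<And>m. m < n \<Longrightarrow> g m \<in> C4" "\<And>m. m < n \<Longrightarrow> b' m = b (g m)" by metis
  have a0f: "finite a0" "card a0 = k - card D"
    using \<gamma> C4D cardC4 fina \<open>finite D\<close> by (auto simp: card_Diff_subset)
  have index: "\<exists>i<k - card D. \<alpha> = sorted_list_of_set a0 ! i" if "\<alpha> \<in> a0" for \<alpha>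
    using that a0f by (metis in_set_conv_nth length_sorted_list_of_set set_sorted_list_of_set)
  \<comment> \<open>The positions \<open>i\<close> and \<open>j\<close> exist because \<open>\<alpha> \<in> a0\<close> and \<open>l > 0\<close>; without them the order
    statement in Moore's property would be void.\<close>
  have less: "\<alpha> < \<beta>" if "\<alpha> \<in> a0" "m < n" "\<beta> \<in> b (g m)" for \<alpha> \<beta> m
    using osc index[OF that(1)] \<open>l > 0\<close> that g(2) unfolding set_less_def by metis
  have shift: "f \<alpha> (sorted_list_of_set (b (g m)) ! j) = f \<alpha> (sorted_list_of_set (b (g 0)) ! j) + m"
    if "\<alpha> \<in> a0" "m < n" "j < l" for \<alpha> m j
  proof -
    obtain i where "i < k - card D" "\<alpha> = sorted_list_of_set a0 ! i" using index[OF \<open>\<alpha> \<in> a0\<close>] by blast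
    then show ?thesis using osc[rule_format, of i j m] that(2,3) g(2)[of m] g(2)[of 0] by simp
  qed
  have Wshift: "W (b (g m)) \<alpha> = W (b (g 0)) \<alpha> + int m * sum_list cs" if "\<alpha> \<in> a0" "m < n" for \<alpha> m
  proof -
    have w: "w_exp f (sorted_list_of_set (b (g m)) ! j) \<alpha>
           = w_exp f (sorted_list_of_set (b (g 0)) ! j) \<alpha> + int m" if "j < length cs" for j
    proof -
      have "sorted_list_of_set (b (g i)) ! j \<in> b (g i)" for i
        using b(1) Y \<open>j < length cs\<close> by (metis nth_mem set_sorted_list_of_set)
      then have "\<alpha> < sorted_list_of_set (b (g m)) ! j" "\<alpha> < sorted_list_of_set (b (g 0)) ! j"
        using less[OF \<open>\<alpha> \<in> a0\<close>] \<open>m < n\<close> by auto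
      then show ?thesis using shift[OF \<open>\<alpha> \<in> a0\<close> \<open>m < n\<close>] that by (simp add: w_exp_def l_def)
    qed
    have "sum_list cs = (\<Sum>j<length cs. cs ! j)" by (simp add: sum_list_sum_nth lessThan_atLeast0)
    moreover have "(\<Sum>j<length cs. cs ! j * w_exp f (sorted_list_of_set (b (g m)) ! j) \<alpha>)
        = (\<Sum>j<length cs. cs ! j * w_exp f (sorted_list_of_set (b (g 0)) ! j) \<alpha>)
          + int m * (\<Sum>j<length cs. cs ! j)"
      by (simp add: w algebra_simps sum.distrib sum_distrib_left)
    ultimately show ?thesis
      by (simp add: W_def Y_def word_exp_append word_exp_zip[OF Y])
  qed
  have nz: "norm (z \<alpha>) = 1" for \<alpha> using z[of \<alpha>] by simp
  have "(\<lambda>\<alpha>. z \<alpha> powi (W (b \<gamma>) \<alpha> - W (b (g 0)) \<alpha>)) \<in> a \<gamma> \<rightarrow> sphere 0 1"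
    by (auto simp: norm_power_int nz)
  then obtain t where t: "t < n" and close: "\<And>\<alpha>. \<alpha> \<in> a \<gamma> \<Longrightarrow>
      dist (z \<alpha> powi (int t * sum_list cs)) (z \<alpha> powi (W (b \<gamma>) \<alpha> - W (b (g 0)) \<alpha>)) < \<epsilon> (Y (b \<gamma>))"
    using N[of "\<lambda>\<alpha>. z \<alpha> powi (W (b \<gamma>) \<alpha> - W (b (g 0)) \<alpha>)" \<gamma>] NC4[OF \<gamma>(1)] by auto
  have "\<gamma> < g t"
  proof -
    have "Min (b \<gamma>) < Min (b (g t))" using less[OF _ t Minb] MinC4[OF \<gamma>(1)] \<gamma>(2) by blast
    then show ?thesis using sep[OF _ _ Minb Minb, of "g t" \<gamma>] \<gamma>(1) C4(2)
      by (metis less_asym less_irrefl linorder_neqE subsetD)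
  qed
  have "g t \<in> C" using g(1)[OF t] C4(2) by blast
  have "Y (b \<gamma>) \<in> lists ((X \<inter> {..<g t}) \<times> UNIV)"
  proof -
    have "\<beta> \<in> X \<and> \<beta> < g t" if "(\<beta>, k) \<in> set (Y (b \<gamma>))" for \<beta> k
    proof (cases "(\<beta>, k) \<in> set xs")
      case True
      then have "\<beta> \<in> X" using xs by (auto simp: in_lists_conv_set)
      moreover have "\<beta> < \<gamma>0" using True \<gamma>0 by force
      ultimately show ?thesis using \<open>g t \<in> C\<close> by (auto simp: C_def)
    next
      case False
      then have "(\<beta>, k) \<in> set (zip (sorted_list_of_set (b \<gamma>)) cs)" using that by (simp add: Y_def)
      then have "\<beta> \<in> b \<gamma>" using b(1) by (metis set_sorted_list_of_set set_zip_leftD)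
      then show ?thesis using b(2)[of \<gamma>] \<open>g t \<in> C\<close> \<open>\<gamma> < g t\<close> by (auto simp: C_def)
    qed
    then show ?thesis by (auto simp: in_lists_conv_set)
  qed
  then obtain \<alpha> where \<alpha>: "\<alpha> \<in> A (Y (b \<gamma>))"
    "\<not> dist (z \<alpha> powi W (b \<gamma>) \<alpha>) (z \<alpha> powi W (b (g t)) \<alpha>) < \<epsilon> (Y (b \<gamma>))"
    using bad[of "g t"] unfolding near_def W_def by blast
  show False
  proof (cases "\<alpha> \<in> D")
    case True
    then show False using \<alpha>(2) root[OF \<gamma>(1) g(1)[OF t] True] \<epsilon> by simp
  next
    case False
    then have "\<alpha> \<in> a0" using \<alpha>(1) \<gamma>(2) by (simp add: a_def)
    then show False
      using \<alpha> close[of \<alpha>] Wshift[OF _ t] dist_powi_shift[OF nz] by (simp add: a_def dist_commute)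
  qed
qed

section \<open>Compact sets in products\<close>

text \<open>
  The Lebesgue number argument: every point of \<open>S\<close> has a basic neighbourhood whose double is inside \<open>U\<close>,
  and finitely many of them cover \<open>S\<close>.
\<close>
lemma compactin_product_tube:
  fixes T :: "'i \<Rightarrow> 'b::metric_space set"
  assumes S: "compactin (product_topology (\<lambda>i. top_of_set (T i)) X) S" and "S \<subseteq> U"
    and U: "openin (product_topology (\<lambda>i. top_of_set (T i)) X) U"
  shows "\<exists>A \<epsilon>. finite A \<and> A \<subseteq> X \<and> \<epsilon> > 0 \<and>
           (\<forall>s\<in>S. \<forall>x\<in>PiE X T. (\<forall>i\<in>A. dist (s i) (x i) < \<epsilon>) \<longrightarrow> x \<in> U)"
proof -
  define R where "R s A e \<longleftrightarrow> finite A \<and> A \<subseteq> X \<and> e > 0 \<and>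
      (\<forall>x\<in>PiE X T. (\<forall>i\<in>A. dist (s i) (x i) < 2 * e) \<longrightarrow> x \<in> U)" for s :: "'i \<Rightarrow> 'b" and A and e :: real
  have "\<exists>A e. R s A e" if "s \<in> S" for s
  proof -
    have "s \<in> U" using that \<open>S \<subseteq> U\<close> by blast
    then obtain V where fin: "finite {i \<in> X. V i \<noteq> T i}"
      and V: "\<And>i. i \<in> X \<Longrightarrow> openin (top_of_set (T i)) (V i)" and s: "s \<in> PiE X V" and sub: "PiE X V \<subseteq> U"
      using U unfolding openin_product_topology_alt by (metis (no_types, lifting) Collect_cong topspace_euclidean_subtopology)
    define A where "A = {i \<in> X. V i \<noteq> T i}"
    have "\<exists>d>0. \<forall>y\<in>T i. dist y (s i) < d \<longrightarrow> y \<in> V i" if "i \<in> A" for i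
    proof -
      have "i \<in> X" using that by (simp add: A_def)
      then have "s i \<in> V i" using s by auto
      then show ?thesis using V[OF \<open>i \<in> X\<close>] unfolding openin_euclidean_subtopology_iff by blast
    qed
    then have "\<forall>i\<in>A. \<exists>d. d > 0 \<and> (\<forall>y\<in>T i. dist y (s i) < d \<longrightarrow> y \<in> V i)" by blast
    from bchoice[OF this] obtain d where
      d: "\<And>i. i \<in> A \<Longrightarrow> d i > 0" "\<And>i y. i \<in> A \<Longrightarrow> y \<in> T i \<Longrightarrow> dist y (s i) < d i \<Longrightarrow> y \<in> V i" by blast
    define e where "e = Min (insert 1 (d ` A)) / 2"
    have "finite A" using fin by (simp add: A_def)
    then have e: "2 * e \<le> d i" if "i \<in> A" for i
      using that by (auto simp: e_def)
    have "e > 0" using d(1) \<open>finite A\<close> by (auto simp: e_def)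
    have "x \<in> U" if x: "x \<in> PiE X T" "\<forall>i\<in>A. dist (s i) (x i) < 2 * e" for x
    proof -
      have "x i \<in> V i" if "i \<in> X" for i
      proof (cases "i \<in> A")
        case True
        have "dist (x i) (s i) < d i" using e[OF True] x(2) True by (metis dist_commute less_le_trans)
        then show ?thesis using d(2)[OF True] x(1) that by auto
      next
        case False
        then show ?thesis using x(1) that by (auto simp: A_def)
      qed
      then have "x \<in> PiE X V" using x(1) by (auto simp: PiE_iff)
      then show ?thesis using sub by blast
    qed
    moreover have "A \<subseteq> X" by (auto simp: A_def)
    ultimately have "R s A e" using \<open>finite A\<close> \<open>e > 0\<close> by (auto simp: R_def)
    then show ?thesis by blast
  qed
  then obtain A e where Ae: "\<And>s. s \<in> S \<Longrightarrow> R s (A s) (e s)" by metis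
  then have A: "\<And>s. s \<in> S \<Longrightarrow> finite (A s)" "\<And>s. s \<in> S \<Longrightarrow> A s \<subseteq> X" and e: "\<And>s. s \<in> S \<Longrightarrow> e s > 0"
    and in_U: "\<And>s x. s \<in> S \<Longrightarrow> x \<in> PiE X T \<Longrightarrow> (\<And>i. i \<in> A s \<Longrightarrow> dist (s i) (x i) < 2 * e s) \<Longrightarrow> x \<in> U"
    by (auto simp: R_def)
  define B where "B s = PiE X (\<lambda>i. if i \<in> A s then T i \<inter> ball (s i) (e s) else T i)" for s
  have ST: "S \<subseteq> PiE X T" using compactin_subset_topspace[OF S] by simp
  have openB: "openin (product_topology (\<lambda>i. top_of_set (T i)) X) (B s)" if "s \<in> S" for s
    unfolding B_def
  proof (rule openin_PiE_gen[THEN iffD2], intro disjI2 conjI ballI)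
    show "finite {i \<in> X. (if i \<in> A s then T i \<inter> ball (s i) (e s) else T i) \<noteq> topspace (top_of_set (T i))}"
      by (rule finite_subset[OF _ A(1)[OF that]]) auto
    show "openin (top_of_set (T i)) (if i \<in> A s then T i \<inter> ball (s i) (e s) else T i)" for i
      by (auto intro: openin_open_Int)
  qed
  have "S \<subseteq> \<Union>(B ` S)"
  proof
    fix s assume "s \<in> S"
    then have "s \<in> B s" using ST e by (auto simp: B_def PiE_iff)
    then show "s \<in> \<Union>(B ` S)" using \<open>s \<in> S\<close> by blast
  qed
  then have "\<exists>\<F>. finite \<F> \<and> \<F> \<subseteq> B ` S \<and> S \<subseteq> \<Union>\<F>"
    using compactinD[OF S, of "B ` S"] openB by blast
  then obtain F where F: "F \<subseteq> S" "finite F" "S \<subseteq> \<Union>(B ` F)"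
    by (metis finite_subset_image)
  define \<epsilon> where "\<epsilon> = Min (insert 1 (e ` F))"
  have "\<epsilon> > 0" using F e by (auto simp: \<epsilon>_def)
  have \<epsilon>: "\<epsilon> \<le> e s" if "s \<in> F" for s using F that by (auto simp: \<epsilon>_def)
  have "x \<in> U" if s: "s \<in> S" and x: "x \<in> PiE X T" "\<forall>i\<in>(\<Union>s\<in>F. A s). dist (s i) (x i) < \<epsilon>" for s x
  proof -
    obtain t where t: "t \<in> F" "s \<in> B t" using F(3) s by blast
    then have "t \<in> S" using F(1) by blast
    show ?thesis
    proof (rule in_U[OF \<open>t \<in> S\<close> x(1)])
      fix i assume i: "i \<in> A t"
      then have "i \<in> X" using A(2) \<open>t \<in> S\<close> by blast
      then have "dist (t i) (s i) < e t" using t(2) i by (auto simp: B_def PiE_iff)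
      moreover have "dist (s i) (x i) < e t" using x(2) i t(1) \<epsilon>[OF t(1)] by force
      ultimately show "dist (t i) (x i) < 2 * e t" using dist_triangle[of "t i" "x i" "s i"] by linarith
    qed
  qed
  moreover have "finite (\<Union>s\<in>F. A s)" using F A(1) by auto
  moreover have "(\<Union>s\<in>F. A s) \<subseteq> X" using F(1) A(2) by blast
  ultimately show ?thesis
    using \<open>\<epsilon> > 0\<close> by (intro exI[of _ "\<Union>s\<in>F. A s"] exI[of _ \<epsilon>]) (simp only: simp_thms, auto)
qed

section \<open>The group as a set of integer exponent functions\<close>

lemma group_circle_group: "group circle_group"
proof (rule groupI)
  fix x assume "x \<in> carrier circle_group"
  then have "inverse x \<in> carrier circle_group" "inverse x * x = 1"
    by (auto simp: circle_group_def norm_inverse intro!: left_inverse)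
  then show "\<exists>y\<in>carrier circle_group. y \<otimes>\<^bsub>circle_group\<^esub> x = \<one>\<^bsub>circle_group\<^esub>"
    by (auto simp: circle_group_def)
qed (auto simp: circle_group_def norm_mult)

lemma inv_circle_group:
  assumes "x \<in> sphere 0 1"
  shows "inv\<^bsub>circle_group\<^esub> x = inverse x"
proof (rule group.inv_equality[OF group_circle_group])
  have "x \<noteq> 0" using assms by auto
  then show "inverse x \<otimes>\<^bsub>circle_group\<^esub> x = \<one>\<^bsub>circle_group\<^esub>"
    by (simp add: circle_group_def)
qed (use assms in \<open>auto simp: circle_group_def norm_inverse\<close>)

definition torus_point :: "('a \<Rightarrow> complex) \<Rightarrow> 'a set \<Rightarrow> ('a \<Rightarrow> int) \<Rightarrow> 'a \<Rightarrow> complex" where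
  "torus_point z X q = (\<lambda>\<alpha>\<in>X. z \<alpha> powi q \<alpha>)"

lemma torus_point_in_sphere:
  assumes "\<And>\<alpha>. z \<alpha> \<in> sphere 0 1"
  shows "torus_point z X q \<in> (\<Pi>\<^sub>E \<alpha>\<in>X. sphere 0 1)"
proof -
  have "norm (z \<alpha>) = 1" for \<alpha> using assms[of \<alpha>] by simp
  then show ?thesis by (auto simp: torus_point_def norm_power_int)
qed

lemma torus_point_0: "\<one>\<^bsub>torus_group X\<^esub> = torus_point z X (\<lambda>_. 0)"
  by (simp add: torus_group_def torus_point_def circle_group_def)

lemma torus_point_add:
  assumes "\<And>\<alpha>. z \<alpha> \<in> sphere 0 1"
  shows "torus_point z X p \<otimes>\<^bsub>torus_group X\<^esub> torus_point z X q = torus_point z X (\<lambda>\<alpha>. p \<alpha> + q \<alpha>)"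
proof -
  have "z \<alpha> \<noteq> 0" for \<alpha> using assms[of \<alpha>] by auto
  then show ?thesis
    by (auto simp: torus_group_def torus_point_def circle_group_def power_int_add)
qed

lemma torus_point_uminus:
  assumes "\<And>\<alpha>. z \<alpha> \<in> sphere 0 1"
  shows "inv\<^bsub>torus_group X\<^esub> (torus_point z X q) = torus_point z X (\<lambda>\<alpha>. - q \<alpha>)"
proof -
  have nz: "norm (z \<alpha>) = 1" for \<alpha> using assms[of \<alpha>] by simp
  have "torus_point z X q \<in> (\<Pi>\<^sub>E \<alpha>\<in>X. carrier circle_group)"
    using torus_point_in_sphere[OF assms] by (simp add: circle_group_def)
  then have "inv\<^bsub>torus_group X\<^esub> (torus_point z X q) = (\<lambda>\<alpha>\<in>X. inv\<^bsub>circle_group\<^esub> (torus_point z X q \<alpha>))"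
    unfolding torus_group_def by (intro inv_product_group group_circle_group)
  also have "\<dots> = torus_point z X (\<lambda>\<alpha>. - q \<alpha>)"
    by (auto simp: torus_point_def inv_circle_group norm_power_int nz power_int_minus)
  finally show ?thesis .
qed

lemma generate_L_space:
  assumes z: "\<And>\<alpha>. z \<alpha> \<in> sphere 0 1"
  shows "generate (torus_group X) (L_space e L z X)
       = (\<lambda>xs. torus_point z X (word_exp (osc e L) xs)) ` lists (X \<times> UNIV)" (is "?G = ?W")
proof -
  have gen: "restrict (w_point e L z \<beta>) X = torus_point z X (w_exp (osc e L) \<beta>)" for \<beta>
    unfolding torus_point_def w_exp_def w_point_def
    by (rule restrict_ext) (simp add: power_int_add_1' flip: power_int_of_nat)
  have single: "word_exp (osc e L) [(\<beta>, k)] = (\<lambda>\<alpha>. k * w_exp (osc e L) \<beta> \<alpha>)" for \<beta> k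
    by (rule ext) (simp add: word_exp_def)
  have nil: "word_exp (osc e L) [] = (\<lambda>_. 0)"
    by (rule ext) (simp add: word_exp_def)
  show ?thesis
  proof (intro equalityI subsetI)
    fix x assume "x \<in> ?G"
    then show "x \<in> ?W"
    proof (induction rule: generate.induct)
      case one
      show ?case using torus_point_0[of X z] by (intro image_eqI[of _ _ "[]"]) (simp_all add: nil)
    next
      case (incl h)
      then obtain \<beta> where "\<beta> \<in> X" "h = torus_point z X (w_exp (osc e L) \<beta>)"
        by (auto simp: L_space_def gen)
      then show ?case by (intro image_eqI[of _ _ "[(\<beta>, 1)]"]) (simp_all add: single)
    next
      case (inv h)
      then obtain \<beta> where "\<beta> \<in> X" "h = torus_point z X (w_exp (osc e L) \<beta>)"
        by (auto simp: L_space_def gen)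
      then show ?case
        by (intro image_eqI[of _ _ "[(\<beta>, -1)]"]) (simp_all add: single torus_point_uminus[OF z])
    next
      case (eng h1 h2)
      then obtain xs ys where "xs \<in> lists (X \<times> UNIV)" "h1 = torus_point z X (word_exp (osc e L) xs)"
        "ys \<in> lists (X \<times> UNIV)" "h2 = torus_point z X (word_exp (osc e L) ys)" by blast
      then show ?case
        by (intro image_eqI[of _ _ "xs @ ys"]) (simp_all add: torus_point_add[OF z] word_exp_append[abs_def])
    qed
  next
    fix x assume "x \<in> ?W"
    then obtain xs where xs: "xs \<in> lists (X \<times> UNIV)" and x: "x = torus_point z X (word_exp (osc e L) xs)"
      by blast
    have pow: "torus_point z X (\<lambda>\<alpha>. k * w_exp (osc e L) \<beta> \<alpha>) \<in> ?G" if "\<beta> \<in> X" for k \<beta>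
    proof (induction k rule: int_induct[of _ 0])
      case base
      then show ?case using torus_point_0[of X z] generate.one[of "torus_group X"] by simp
    next
      case (step1 i)
      have "torus_point z X (w_exp (osc e L) \<beta>) \<in> ?G"
        using that gen by (intro generate.incl) (auto simp: L_space_def)
      from generate.eng[OF step1.IH this] show ?case
        by (simp add: torus_point_add[OF z] algebra_simps)
    next
      case (step2 i)
      have "inv\<^bsub>torus_group X\<^esub> (torus_point z X (w_exp (osc e L) \<beta>)) \<in> ?G"
        using that gen by (intro generate.inv) (auto simp: L_space_def)
      from generate.eng[OF step2.IH this] show ?case
        by (simp add: torus_point_add[OF z] torus_point_uminus[OF z] algebra_simps)
    qed
    from xs have "torus_point z X (word_exp (osc e L) xs) \<in> ?G"
    proof (induction xs)
      case Nil
      then show ?case using torus_point_0[of X z] generate.one[of "torus_group X"] by (simp add: nil)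
    next
      case (Cons y ys)
      obtain \<beta> k where y: "y = (\<beta>, k)" by (cases y)
      then have "word_exp (osc e L) (y # ys) = (\<lambda>\<alpha>. k * w_exp (osc e L) \<beta> \<alpha> + word_exp (osc e L) ys \<alpha>)"
        by (intro ext) (simp add: word_exp_def)
      then show ?case
        using generate.eng[OF pow[of \<beta> k] Cons.IH] Cons.hyps y by (simp add: torus_point_add[OF z])
    qed
    then show "x \<in> ?G" using x by simp
  qed
qed

lemma G_set_eq:
  assumes z: "\<And>\<alpha>. z \<alpha> \<in> sphere 0 1"
  shows "G_set e L z X = {torus_point z X (\<lambda>\<alpha>. word_exp (osc e L) xs \<alpha> + p \<alpha>) | xs p.
           xs \<in> lists (X \<times> UNIV) \<and> bdd_above (range (\<lambda>\<alpha>. \<bar>p \<alpha>\<bar>))}" (is "_ = ?R")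
proof -
  have K: "(\<lambda>h. restrict h X) ` K_set z = {torus_point z X p | p. bdd_above (range (\<lambda>\<alpha>. \<bar>p \<alpha>\<bar>))}"
    by (auto simp: K_set_def torus_point_def)
  show ?thesis
    unfolding G_set_def generate_L_space[OF z] K set_mult_def torus_point_add[OF z, symmetric]
    by blast
qed

text \<open>
  The set is a product of finite subsets of the circle.
\<close>
lemma compactin_bounded_translates:
  fixes z :: "'a \<Rightarrow> complex" and q :: "'a \<Rightarrow> int" and n :: nat
  assumes z: "\<And>\<alpha>. z \<alpha> \<in> sphere 0 1"
  shows "compactin (torus_topology X) {torus_point z X (\<lambda>\<alpha>. q \<alpha> + p \<alpha>) | p. \<forall>\<alpha>. \<bar>p \<alpha>\<bar> \<le> int n}"
    (is "compactin _ ?S")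
proof -
  define V where "V \<alpha> = (\<lambda>j. z \<alpha> powi (q \<alpha> + j)) ` {- int n..int n}" for \<alpha>
  have "?S = PiE X V"
  proof (intro equalityI subsetI)
    fix x assume "x \<in> ?S"
    then obtain p where p: "\<And>\<alpha>. \<bar>p \<alpha>\<bar> \<le> int n" "x = torus_point z X (\<lambda>\<alpha>. q \<alpha> + p \<alpha>)" by blast
    have "p \<alpha> \<in> {- int n..int n}" for \<alpha> using p(1)[of \<alpha>] by (simp add: abs_le_iff)
    then show "x \<in> PiE X V" unfolding p(2) torus_point_def V_def by auto
  next
    fix x assume x: "x \<in> PiE X V"
    have "\<exists>j. \<bar>j\<bar> \<le> int n \<and> (\<alpha> \<in> X \<longrightarrow> x \<alpha> = z \<alpha> powi (q \<alpha> + j))" for \<alpha>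
    proof (cases "\<alpha> \<in> X")
      case True
      then have "x \<alpha> \<in> V \<alpha>" using x by auto
      then obtain j where "j \<in> {- int n..int n}" "x \<alpha> = z \<alpha> powi (q \<alpha> + j)" by (auto simp: V_def)
      then show ?thesis by (intro exI[of _ j]) auto
    qed (auto intro: exI[of _ 0])
    then obtain p where p: "\<And>\<alpha>. \<bar>p \<alpha>\<bar> \<le> int n" "\<And>\<alpha>. \<alpha> \<in> X \<Longrightarrow> x \<alpha> = z \<alpha> powi (q \<alpha> + p \<alpha>)"
      by metis
    have "x = torus_point z X (\<lambda>\<alpha>. q \<alpha> + p \<alpha>)"
      using x p(2) by (auto simp: torus_point_def PiE_iff extensional_def)
    then show "x \<in> ?S" using p(1) by blast
  qed
  moreover have "compactin (top_of_set (sphere 0 1)) (V \<alpha>)" for \<alpha>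
  proof (rule finite_imp_compactin)
    have "norm (z \<alpha>) = 1" using z[of \<alpha>] by simp
    then show "V \<alpha> \<subseteq> topspace (top_of_set (sphere 0 1))" by (auto simp: V_def norm_power_int)
  qed (simp add: V_def)
  ultimately show ?thesis by (simp add: torus_topology_def compactin_PiE)
qed

section \<open>The Lindeloef property\<close>

theorem mainTheorem3:
  fixes e :: "'a::wellorder \<Rightarrow> 'a \<Rightarrow> nat"
    and L :: "'a \<Rightarrow> 'a \<Rightarrow> 'a set"
    and z :: "'a \<Rightarrow> complex"
    and X :: "'a set"
  assumes "is_omega1 TYPE('a)"
    and "coherent_seq e"
    and "lower_trace L"
    and "moore_property (osc e L)"
    and "\<And>\<alpha>. z \<alpha> \<in> sphere 0 1"
    and "rationally_independent z"
    and "uncountable X"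
  shows "Lindelof_space (subtopology (torus_topology X) (G_set e L z X))"
proof -
  note om = assms(1) and coh = assms(2) and lt = assms(3) and moore = assms(4)
    and z = assms(5) and ind = assms(6)
  define f where "f = osc e L"
  define G where "G = G_set e L z X"
  define S where "S xs n = {torus_point z X (\<lambda>\<alpha>. word_exp f xs \<alpha> + p \<alpha>) | p. \<forall>\<alpha>. \<bar>p \<alpha>\<bar> \<le> int n}"
    for xs and n :: nat
  have G: "G = (\<Union>xs\<in>lists (X \<times> UNIV). \<Union>n. S xs n)"
  proof (intro equalityI subsetI)
    fix x assume "x \<in> G"
    then obtain xs p where xs: "xs \<in> lists (X \<times> UNIV)" and bdd: "bdd_above (range (\<lambda>\<alpha>. \<bar>p \<alpha>\<bar>))"
      and x: "x = torus_point z X (\<lambda>\<alpha>. word_exp f xs \<alpha> + p \<alpha>)"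
      unfolding G_def G_set_eq[OF z] f_def by blast
    obtain m where m: "\<And>\<alpha>. \<bar>p \<alpha>\<bar> \<le> m" using bdd by (auto simp: bdd_above_def)
    have "\<bar>p \<alpha>\<bar> \<le> int (nat m)" for \<alpha> using m[of \<alpha>] by linarith
    then show "x \<in> (\<Union>xs\<in>lists (X \<times> UNIV). \<Union>n. S xs n)" using xs x unfolding S_def by blast
  next
    fix x assume "x \<in> (\<Union>xs\<in>lists (X \<times> UNIV). \<Union>n. S xs n)"
    then obtain xs n p where xs: "xs \<in> lists (X \<times> UNIV)" and p: "\<forall>\<alpha>. \<bar>p \<alpha>\<bar> \<le> int n"
      and x: "x = torus_point z X (\<lambda>\<alpha>. word_exp f xs \<alpha> + p \<alpha>)"
      unfolding S_def by blast
    have "bdd_above (range (\<lambda>\<alpha>. \<bar>p \<alpha>\<bar>))" using p by (auto simp: bdd_above_def)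
    then show "x \<in> G" using xs x unfolding G_def G_set_eq[OF z] f_def by blast
  qed
  have top: "topspace (torus_topology X) = (\<Pi>\<^sub>E \<alpha>\<in>X. sphere 0 1)"
    by (simp add: torus_topology_def)
  have sub: "S xs n \<subseteq> topspace (torus_topology X)" for xs n
  proof
    fix x assume "x \<in> S xs n"
    then obtain q where "x = torus_point z X q" unfolding S_def by blast
    then show "x \<in> topspace (torus_topology X)" unfolding top by (simp only: torus_point_in_sphere[OF z])
  qed
  have nz: "norm (z \<alpha>) = 1" for \<alpha> using z[of \<alpha>] by simp

  have "\<exists>\<V>. countable \<V> \<and> \<V> \<subseteq> \<U> \<and> G \<subseteq> \<Union>\<V>"
    if \<U>: "\<And>U. U \<in> \<U> \<Longrightarrow> openin (subtopology (torus_topology X) G) U" and cover: "G \<subseteq> \<Union>\<U>" for \<U>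
  proof -
    have "\<forall>U\<in>\<U>. \<exists>W. openin (torus_topology X) W \<and> U = W \<inter> G"
      using \<U> by (simp add: openin_subtopology)
    from bchoice[OF this] obtain W where W: "\<And>U. U \<in> \<U> \<Longrightarrow> openin (torus_topology X) (W U)"
      "\<And>U. U \<in> \<U> \<Longrightarrow> U = W U \<inter> G" by blast
    have fin: "\<exists>\<V>. finite \<V> \<and> \<V> \<subseteq> \<U> \<and> S xs n \<subseteq> \<Union>(W ` \<V>)" if "xs \<in> lists (X \<times> UNIV)" for xs n
    proof -
      have "compactin (torus_topology X) (S xs n)"
        unfolding S_def by (rule compactin_bounded_translates[OF z])
      moreover have "S xs n \<subseteq> \<Union>(W ` \<U>)" using that cover W(2) G by blast
      ultimately have "\<exists>\<F>. finite \<F> \<and> \<F> \<subseteq> W ` \<U> \<and> S xs n \<subseteq> \<Union>\<F>"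
        using compactinD[of "torus_topology X" "S xs n" "W ` \<U>"] W(1) by blast
      then show ?thesis by (metis finite_subset_image)
    qed
    define tube where "tube xs n \<V> A \<epsilon> \<longleftrightarrow> (\<forall>s\<in>S xs n. \<forall>x\<in>(\<Pi>\<^sub>E \<alpha>\<in>X. sphere 0 1).
        (\<forall>\<alpha>\<in>A. dist (s \<alpha>) (x \<alpha>) < \<epsilon>) \<longrightarrow> x \<in> \<Union>(W ` \<V>))" for xs n \<V> A and \<epsilon> :: real
    have "\<exists>\<V> A \<epsilon>. finite \<V> \<and> \<V> \<subseteq> \<U> \<and> finite A \<and> \<epsilon> > 0 \<and>
            (xs \<in> lists (X \<times> UNIV) \<longrightarrow> A \<subseteq> X \<and> tube xs n \<V> A \<epsilon>)" for xs n
    proof (cases "xs \<in> lists (X \<times> UNIV)")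
      case False
      then show ?thesis by (intro exI[of _ "{}"] exI[of _ 1]) auto
    next
      case True
      from fin[OF True, of n] obtain \<V> where V: "finite \<V>" "\<V> \<subseteq> \<U>" "S xs n \<subseteq> \<Union>(W ` \<V>)"
        by (elim exE conjE)
      have "openin (torus_topology X) (\<Union>(W ` \<V>))" using V(2) W(1) by blast
      moreover have "compactin (torus_topology X) (S xs n)"
        unfolding S_def by (rule compactin_bounded_translates[OF z])
      ultimately have "\<exists>A \<epsilon>. finite A \<and> A \<subseteq> X \<and> \<epsilon> > 0 \<and> tube xs n \<V> A \<epsilon>"
        unfolding torus_topology_def tube_def by (intro compactin_product_tube V(3))
      then show ?thesis using V(1,2) by blast
    qed
    then obtain \<V> A \<epsilon> where V: "\<And>xs n. finite (\<V> xs n)" "\<And>xs n. \<V> xs n \<subseteq> \<U>"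
      and A: "\<And>xs n. finite (A xs n)" and \<epsilon>: "\<And>xs n. \<epsilon> xs n > 0"
      and AX: "\<And>xs n. xs \<in> lists (X \<times> UNIV) \<Longrightarrow> A xs n \<subseteq> X"
      and tube: "\<And>xs n. xs \<in> lists (X \<times> UNIV) \<Longrightarrow> tube xs n (\<V> xs n) (A xs n) (\<epsilon> xs n)"
      by metis
    have near: "x \<in> \<Union>(W ` \<V> xs n)" if "xs \<in> lists (X \<times> UNIV)" "s \<in> S xs n" "x \<in> (\<Pi>\<^sub>E \<alpha>\<in>X. sphere 0 1)"
        "\<And>\<alpha>. \<alpha> \<in> A xs n \<Longrightarrow> dist (s \<alpha>) (x \<alpha>) < \<epsilon> xs n" for xs n s x
      using tube[OF that(1)] that(2-4) unfolding tube_def by blast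

    \<comment> \<open>The stages \<open>\<Gamma> xs cs n\<close> and the supports \<open>A xs n\<close> are the data under which \<open>\<delta>\<close> has to be
      closed.\<close>
    have "\<exists>\<gamma>. xs \<in> lists (X \<times> UNIV) \<and> sum_list cs \<noteq> 0 \<longrightarrow>
        (\<forall>b. finite b \<and> b \<subseteq> X \<inter> {\<gamma>..} \<and> card b = length cs \<longrightarrow>
           (\<exists>ys\<in>lists ((X \<inter> {..<\<gamma>}) \<times> UNIV). \<forall>\<alpha>\<in>A ys n.
              dist (z \<alpha> powi word_exp f ys \<alpha>)
                   (z \<alpha> powi word_exp f (xs @ zip (sorted_list_of_set b) cs) \<alpha>) < \<epsilon> ys n))" for xs cs n
      using word_approximation[OF om moore[folded f_def] z ind, of xs X cs "\<lambda>ys. A ys n" "\<lambda>ys. \<epsilon> ys n"] A \<epsilon>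
      by blast
    then obtain \<Gamma> where \<Gamma>: "\<And>xs cs n b. xs \<in> lists (X \<times> UNIV) \<Longrightarrow> sum_list cs \<noteq> 0 \<Longrightarrow>
        finite b \<Longrightarrow> b \<subseteq> X \<inter> {\<Gamma> xs cs n..} \<Longrightarrow> card b = length cs \<Longrightarrow>
           (\<exists>ys\<in>lists ((X \<inter> {..<\<Gamma> xs cs n}) \<times> UNIV). \<forall>\<alpha>\<in>A ys n.
              dist (z \<alpha> powi word_exp f ys \<alpha>)
                   (z \<alpha> powi word_exp f (xs @ zip (sorted_list_of_set b) cs) \<alpha>) < \<epsilon> ys n)"
      by metis
    have "\<exists>\<delta>. \<forall>xs\<in>lists ({..<\<delta>} \<times> UNIV). \<forall>c. insert (\<Gamma> xs (fst c) (snd c)) (A xs (snd c)) \<subseteq> {..<\<delta>}"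
      by (rule omega1_closed_under_words[OF om]) (simp add: A countable_finite)
    then obtain \<delta> where \<delta>: "\<And>xs cs n. xs \<in> lists ({..<\<delta>} \<times> UNIV) \<Longrightarrow> \<Gamma> xs cs n < \<delta>"
      "\<And>xs n. xs \<in> lists ({..<\<delta>} \<times> UNIV) \<Longrightarrow> A xs n \<subseteq> {..<\<delta>}"
      by (metis (no_types, lifting) fst_conv insert_subset lessThan_iff snd_conv)
    define Q where "Q = lists ((X \<inter> {..<\<delta>}) \<times> (UNIV :: int set))"
    define \<V>' where "\<V>' = (\<Union>xs\<in>Q. \<Union>n. \<V> xs n)"
    have "countable (X \<inter> {..<\<delta>})" using om by (auto simp: is_omega1_def)
    then have "countable Q" unfolding Q_def by (intro countable_lists countable_SIGMA) auto
    then have "countable \<V>'" unfolding \<V>'_def using V(1) countable_finite by blast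
    moreover have "\<V>' \<subseteq> \<U>" unfolding \<V>'_def using V(2) by blast
    moreover have "G \<subseteq> \<Union>\<V>'"
    proof
      fix y assume "y \<in> G"
      then obtain ys n p where ys: "ys \<in> lists (X \<times> UNIV)" and p: "\<And>\<alpha>. \<bar>p \<alpha>\<bar> \<le> int n"
        and y: "y = torus_point z X (\<lambda>\<alpha>. word_exp f ys \<alpha> + p \<alpha>)" unfolding G S_def by blast
      have yP: "y \<in> (\<Pi>\<^sub>E \<alpha>\<in>X. sphere 0 1)" unfolding y by (rule torus_point_in_sphere[OF z])
      define lo where "lo = filter (\<lambda>x. fst x < \<delta>) ys"
      define hi where "hi = filter (\<lambda>x. \<not> fst x < \<delta>) ys"
      have split: "word_exp f ys \<alpha> = word_exp f lo \<alpha> + word_exp f hi \<alpha>" for \<alpha>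
        unfolding lo_def hi_def word_exp_def by (induction ys) auto
      have lo: "lo \<in> Q" "lo \<in> lists (X \<times> UNIV)" "lo \<in> lists ({..<\<delta>} \<times> UNIV)"
        using ys by (auto simp: lo_def Q_def in_lists_conv_set)
      have hi: "\<beta> \<in> X" "\<delta> \<le> \<beta>" if "(\<beta>, k) \<in> set hi" for \<beta> k
        using that ys by (auto simp: hi_def in_lists_conv_set)
      have covered: "y \<in> \<Union>\<V>'" if "xs \<in> Q" and y: "y \<in> \<Union>(W ` \<V> xs m)" for xs m
      proof -
        obtain U where "U \<in> \<V> xs m" "y \<in> W U" using y by blast
        then have "y \<in> U" using V(2) W(2) \<open>y \<in> G\<close> by blast
        then show ?thesis using \<open>U \<in> \<V> xs m\<close> that(1) unfolding \<V>'_def by blast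
      qed
      show "y \<in> \<Union>\<V>'"
      proof (cases "sum_list (map snd hi) = 0")
        case True
        obtain m where m: "\<And>\<alpha>. \<alpha> < \<delta> \<Longrightarrow> \<bar>word_exp f hi \<alpha>\<bar> \<le> m"
          using word_exp_bounded[OF coh lt, of hi \<delta>] hi True unfolding f_def by auto
        \<comment> \<open>The tail is absorbed into the bounded part of the exponent, which costs a larger bound.\<close>
        define p' where "p' \<alpha> = (if \<alpha> < \<delta> then p \<alpha> + word_exp f hi \<alpha> else 0)" for \<alpha>
        have "\<bar>p' \<alpha>\<bar> \<le> int (n + nat m)" for \<alpha>
          using p[of \<alpha>] m[of \<alpha>] by (auto simp: p'_def)
        then have "torus_point z X (\<lambda>\<alpha>. word_exp f lo \<alpha> + p' \<alpha>) \<in> S lo (n + nat m)"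
          unfolding S_def by blast
        moreover have "dist (torus_point z X (\<lambda>\<alpha>. word_exp f lo \<alpha> + p' \<alpha>) \<alpha>) (y \<alpha>) < \<epsilon> lo (n + nat m)"
          if "\<alpha> \<in> A lo (n + nat m)" for \<alpha>
        proof -
          have "\<alpha> < \<delta>" using \<delta>(2)[OF lo(3)] that by blast
          then have "word_exp f lo \<alpha> + p' \<alpha> = word_exp f ys \<alpha> + p \<alpha>" by (simp add: p'_def split)
          then have "torus_point z X (\<lambda>\<alpha>. word_exp f lo \<alpha> + p' \<alpha>) \<alpha> = y \<alpha>"
            by (simp add: y torus_point_def)
          then show ?thesis using \<epsilon> by simp
        qed
        ultimately have "y \<in> \<Union>(W ` \<V> lo (n + nat m))" by (rule near[OF lo(2) _ yP])
        then show ?thesis by (rule covered[OF lo(1)])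
      next
        case False
        obtain b cs where b: "finite b" "b \<subseteq> fst ` set hi" "card b = length cs"
          and cs: "sum_list cs = sum_list (map snd hi)"
          and w: "word_exp f hi = word_exp f (zip (sorted_list_of_set b) cs)"
          using word_normal_form[of hi f] by blast
        have "\<Gamma> lo cs n < \<delta>" by (rule \<delta>(1)[OF lo(3)])
        have "b \<subseteq> X \<inter> {\<Gamma> lo cs n..}"
        proof
          fix \<beta> assume "\<beta> \<in> b"
          then obtain k where "(\<beta>, k) \<in> set hi" using b(2) by auto
          then show "\<beta> \<in> X \<inter> {\<Gamma> lo cs n..}" using hi[of \<beta> k] \<open>\<Gamma> lo cs n < \<delta>\<close> by auto
        qed
        then obtain xs where xs: "xs \<in> lists ((X \<inter> {..<\<Gamma> lo cs n}) \<times> UNIV)"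
          and close: "\<And>\<alpha>. \<alpha> \<in> A xs n \<Longrightarrow> dist (z \<alpha> powi word_exp f xs \<alpha>)
                   (z \<alpha> powi word_exp f (lo @ zip (sorted_list_of_set b) cs) \<alpha>) < \<epsilon> xs n"
          using \<Gamma>[OF lo(2) _ b(1) _ b(3)] False cs by metis
        have xs': "xs \<in> Q" "xs \<in> lists (X \<times> UNIV)"
          using xs \<open>\<Gamma> lo cs n < \<delta>\<close> by (auto simp: Q_def in_lists_conv_set)
        have "torus_point z X (\<lambda>\<alpha>. word_exp f xs \<alpha> + p \<alpha>) \<in> S xs n" using p unfolding S_def by blast
        moreover have "dist (torus_point z X (\<lambda>\<alpha>. word_exp f xs \<alpha> + p \<alpha>) \<alpha>) (y \<alpha>) < \<epsilon> xs n"
          if "\<alpha> \<in> A xs n" for \<alpha>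
        proof -
          have "\<alpha> \<in> X" using AX[OF xs'(2)] that by blast
          have "word_exp f (lo @ zip (sorted_list_of_set b) cs) \<alpha> = word_exp f ys \<alpha>"
            by (simp add: word_exp_append split w)
          then have "dist (z \<alpha> powi word_exp f xs \<alpha>) (z \<alpha> powi word_exp f ys \<alpha>) < \<epsilon> xs n"
            using close[OF that] by simp
          then have "dist (z \<alpha> powi (word_exp f xs \<alpha> + p \<alpha>)) (z \<alpha> powi (p \<alpha> + word_exp f ys \<alpha>)) < \<epsilon> xs n"
            by (simp add: dist_powi_shift[OF nz])
          then show ?thesis using \<open>\<alpha> \<in> X\<close> by (simp add: y torus_point_def add.commute)
        qed
        ultimately have "y \<in> \<Union>(W ` \<V> xs n)" by (rule near[OF xs'(2) _ yP])
        then show ?thesis by (rule covered[OF xs'(1)])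
      qed
    qed
    ultimately show ?thesis by blast
  qed
  moreover have "topspace (subtopology (torus_topology X) G) = G"
    using sub unfolding topspace_subtopology G by blast
  ultimately show ?thesis unfolding Lindelof_space_alt G_def[symmetric] by simp
qed

end
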